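(* Let $q$ be a prime power, let $n>1$ be an integer that is not a prime power, let $1<k<\sigma_0(n)$ (where $\sigma_0(n)$ is the number of positive divisors of $n$), let $\mathbf{d}=(d_1,\ldots,d_k)\in\Lambda_k(n)$, and let $\mathbf{a}=(a_1,\ldots,a_k)\in\mathbb{F}(\mathbf{d})$ be a $\mathbf{d}$-admissible $k$-tuple. If $\mathrm{lcm}(d_1,\ldots,d_k)<n$, then there exists a primitive element $\alpha\in\mathbb{F}_{q^n}$ (i.e., a generator of $\mathbb{F}_{q^n}^*$) such that $\mathrm{Tr}_{n/d_i}(\alpha)=a_i$ for every $1\le i\le k$.
   Context: $\mathbb{F}_q$ is the finite field with $q$ elements. For a divisor $d$ of $n$ and $\alpha\in\mathbb{F}_{q^n}$, $\mathrm{Tr}_{n/d}(\alpha)=\sum_{i=0}^{n/d-1}\alpha^{q^{di}}$. $\Lambda_k(n)$ is the set of $k$-tuples $\mathbf{d}=(d_1,\ldots,d_k)$ of divisors $d_1<\cdots<d_k<n$ of $n$ such that $d_i\nmid d_j$ for all $i\ne j$. For $\mathbf{d}\in\Lambda_k(n)$, $\mathbb{F}(\mathbf{d})=\prod_{i=1}^k\mathbb{F}_{q^{d_i}}$. A tuple $\mathbf{a}=(a_1,\ldots,a_k)\in\mathbb{F}(\mathbf{d})$ is $\mathbf{d}$-admissible if $\mathrm{Tr}_{d_i/\gcd(d_i,d_j)}(a_i)=\mathrm{Tr}_{d_j/\gcd(d_i,d_j)}(a_j)$ for all $1\le i<j\le k$. *)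

theory Defs
  imports
    "HOL-Library.Cardinality"
    "HOL-Computational_Algebra.Computational_Algebra"
    "HOL-Number_Theory.Prime_Powers"
begin

text \<open>
  The ambient field \<open>\<F>\<close> with \<open>q\<^sup>n\<close> elements is an arbitrary type of class \<^class>\<open>finite_field\<close>
  of cardinality \<open>q ^ n\<close>. For \<open>d dvd n\<close>, the field with \<open>q ^ d\<close> elements is the unique
  subfield of that cardinality.
\<close>

definition is_subfield :: "'a :: field set \<Rightarrow> bool" where
  "is_subfield K \<longleftrightarrow> 1 \<in> K \<and> (\<forall>x\<in>K. \<forall>y\<in>K. x - y \<in> K) \<and> (\<forall>x\<in>K. \<forall>y\<in>K. x * y \<in> K)
     \<and> (\<forall>x\<in>K. inverse x \<in> K)"

definition subfield_of_card :: "nat \<Rightarrow> 'a :: field set" where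
  "subfield_of_card m = (THE K. is_subfield K \<and> card K = m)"

text \<open>
  \<open>field_trace q m d\<close> is the trace \<open>Tr\<^bsub>m/d\<^esub>\<close> from the field with \<open>q ^ m\<close> elements to the one with
  \<open>q ^ d\<close> elements; it is meaningful for \<open>d dvd m\<close>, on arguments in \<open>subfield_of_card (q ^ m)\<close>.
\<close>

definition field_trace :: "nat \<Rightarrow> nat \<Rightarrow> nat \<Rightarrow> 'a :: field \<Rightarrow> 'a" where
  "field_trace q m d x = (\<Sum>i<m div d. x ^ (q ^ (d * i)))"

text \<open>
  Tuples are lists, so \<open>d\<^sub>i\<close> with \<open>1 \<le> i \<le> k\<close> is \<open>ds ! (i - 1)\<close>.
\<close>

definition divisor_tuples :: "nat \<Rightarrow> nat \<Rightarrow> nat list set" where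
  "divisor_tuples k n = {ds. length ds = k \<and> (\<forall>d\<in>set ds. d dvd n \<and> d < n)
     \<and> sorted_wrt (<) ds \<and> (\<forall>i<k. \<forall>j<k. i \<noteq> j \<longrightarrow> \<not> ds ! i dvd ds ! j)}"

definition field_tuples :: "nat \<Rightarrow> nat list \<Rightarrow> 'a :: field list set" where
  "field_tuples q ds = {as. length as = length ds
     \<and> (\<forall>i<length ds. as ! i \<in> subfield_of_card (q ^ (ds ! i)))}"

definition admissible :: "nat \<Rightarrow> nat list \<Rightarrow> 'a :: field list \<Rightarrow> bool" where
  "admissible q ds as \<longleftrightarrow> (\<forall>j<length ds. \<forall>i<j.
     field_trace q (ds ! i) (gcd (ds ! i) (ds ! j)) (as ! i)
       = field_trace q (ds ! j) (gcd (ds ! i) (ds ! j)) (as ! j))"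

definition primitive_element :: "'a :: field \<Rightarrow> bool" where
  "primitive_element x \<longleftrightarrow> range (\<lambda>i :: int. x powi i) = UNIV - {0}"


text \<open>
  The definite description in \<open>subfield_of_card\<close> is well defined wherever it is used: if
  \<open>d dvd n\<close>, there is exactly one subfield with \<open>q ^ d\<close> elements.
\<close>

lemma is_subfield_power_card:
  fixes x :: "'a :: finite_field"
  assumes K: "is_subfield K" and x: "x \<in> K"
  shows   "x ^ card K = x"
proof (cases "x = 0")
  case False
  have K': "x / y \<in> K" if "x \<in> K" "y \<in> K" for x y
    using that K by (simp add: is_subfield_def divide_inverse)
  have zero: "0 \<in> K"
    using K unfolding is_subfield_def by (metis diff_self)
  have "(\<Prod>y\<in>K-{0}. x * y) = x ^ card (K - {0}) * \<Prod>(K-{0})"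
    by (simp add: prod.distrib)
  moreover have "(\<Prod>y\<in>K-{0}. x * y) = (\<Prod>y\<in>K-{0}. y)"
    by (rule prod.reindex_bij_witness[of _ "\<lambda>y. y / x" "\<lambda>y. x * y"])
       (use False x K K' in \<open>auto simp: is_subfield_def\<close>)
  ultimately have "x ^ card (K - {0}) = 1"
    by simp
  moreover have "card K = Suc (card (K - {0}))"
    using zero by (subst card_Suc_Diff1) auto
  ultimately show ?thesis
    by simp
next
  case True
  have "card K \<noteq> 0"
    using x by auto
  thus ?thesis
    using True by (simp add: power_0_left)
qed

lemma is_subfield_fixed_points:
  assumes "q = CHAR('a :: finite_field) ^ e"
  shows   "is_subfield {x :: 'a. x ^ q = x}"
proof -
  have "(x - y) ^ q = x - y" if "x ^ q = x" "y ^ q = y" for x y :: 'a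
  proof -
    have "((x - y) + y) ^ q = (x - y) ^ q + y ^ q"
      by (rule freshmans_dream'[OF _ assms]) simp
    thus ?thesis
      using that by (simp add: algebra_simps)
  qed
  thus ?thesis
    by (auto simp: is_subfield_def power_mult_distrib power_inverse)
qed

lemma card_fixed_points:
  assumes card: "CARD('a :: finite_field) = q ^ n" and q: "q > 1" and "d > 0" "d dvd n"
  shows   "card {x :: 'a. x ^ (q ^ d) = x} = q ^ d"
proof -
  define m where "m = q ^ d - 1"
  obtain c where c: "n = d * c"
    using assms by auto
  have "n > 0"
  proof (rule Nat.gr0I)
    assume "n = 0"
    hence "card {0, 1 :: 'a} \<le> 1"
      using card card_mono[of UNIV "{0, 1 :: 'a}"] by simp
    thus False
      by simp
  qed
  have m: "q ^ d = Suc m" "m > 0"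
    using q \<open>d > 0\<close> one_less_power[OF q \<open>d > 0\<close>] by (auto simp: m_def)
  have "m dvd q ^ n - 1"
  proof -
    have "int (q ^ d) ^ c - 1 = (int (q ^ d) - 1) * (\<Sum>i<c. int (q ^ d) ^ i)"
      by (rule power_diff_1_eq)
    also have "int (q ^ d) - 1 = int m"
      by (simp only: m of_nat_Suc)
    finally have "int m dvd int (q ^ d) ^ c - 1"
      by (metis dvd_triv_left)
    hence "int m dvd int (q ^ n - 1)"
      using q by (simp add: c power_mult of_nat_diff)
    thus ?thesis
      by (simp only: int_dvd_int_iff)
  qed
  then obtain t where t: "q ^ n - 1 = m * t"
    by auto
  have qn: "q ^ n > 1"
    using one_less_power[OF q \<open>n > 0\<close>] .
  hence "t > 0"
    using t by (cases t) auto
  define A where "A = {x :: 'a. x \<noteq> 0 \<and> x ^ m = 1}"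
  define S where "S = (\<Sum>i<t. monom (1 :: 'a) (m * i))"
  have fixed: "{x :: 'a. x ^ (q ^ d) = x} = insert 0 A"
    by (auto simp: A_def m)
  have "coeff S 0 = (\<Sum>i<t. if i = 0 then 1 else 0)"
    unfolding S_def coeff_sum using m by (intro sum.cong) auto
  hence S0: "S \<noteq> 0"
    using \<open>t > 0\<close> by auto
  have "degree S \<le> m * (t - 1)"
    unfolding S_def
    by (intro degree_sum_le) (auto intro!: order.trans[OF degree_monom_le])
  hence "card {x. poly S x = 0} \<le> m * (t - 1)"
    using card_poly_roots_bound[OF S0] by linarith
  moreover have "UNIV - {0} \<subseteq> A \<union> {x. poly S x = 0}"
  proof
    fix x :: 'a
    assume x: "x \<in> UNIV - {0}"
    have "x * x ^ (q ^ n - 1) = x ^ (q ^ n)"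
      using qn by (cases "q ^ n") auto
    hence "x ^ (m * t) = 1"
      using finite_field_power_card_eq_same[of x] x by (simp add: card flip: t)
    hence "(x ^ m - 1) * (\<Sum>i<t. (x ^ m) ^ i) = 0"
      by (simp add: power_mult flip: power_diff_1_eq)
    moreover have "poly S x = (\<Sum>i<t. (x ^ m) ^ i)"
      by (simp add: S_def poly_sum poly_monom power_mult)
    ultimately show "x \<in> A \<union> {x. poly S x = 0}"
      using x by (auto simp: A_def)
  qed
  hence "card (UNIV - {0 :: 'a}) \<le> card A + card {x. poly S x = 0}"
    by (meson card_Un_le card_mono finite order.trans)
  moreover have "card (UNIV - {0 :: 'a}) = m * t"
    using t card by (simp add: card_Diff_singleton)
  moreover have "m * t = m + m * (t - 1)"
    using \<open>t > 0\<close> by (cases t) auto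
  ultimately have "card A \<ge> m"
    by linarith
  moreover have "card A \<le> m"
  proof -
    have "coeff (monom (1 :: 'a) m - 1) m = 1"
      using m by (simp add: coeff_1)
    hence nz: "monom (1 :: 'a) m - 1 \<noteq> 0"
      by (metis coeff_0 zero_neq_one)
    have "card A \<le> card {x. poly (monom (1 :: 'a) m - 1) x = 0}"
      by (intro card_mono) (auto simp: A_def poly_monom)
    also have "\<dots> \<le> degree (monom (1 :: 'a) m - 1)"
      by (rule card_poly_roots_bound[OF nz])
    also have "\<dots> \<le> m"
      by (intro degree_diff_le) (auto simp: degree_monom_le)
    finally show ?thesis .
  qed
  moreover have "card (insert 0 A) = Suc (card A)"
    by (simp add: A_def)
  ultimately show ?thesis
    unfolding fixed using m(1) by linarith
qed

lemma
  assumes q: "primepow q" and card: "CARD('a :: finite_field) = q ^ n"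
    and d: "d > 0" "d dvd n"
  shows ex1_subfield_of_card: "\<exists>!K :: 'a set. is_subfield K \<and> card K = q ^ d"
    and subfield_of_card_eq:  "subfield_of_card (q ^ d) = {x :: 'a. x ^ (q ^ d) = x}"
proof -
  obtain p e where p: "prime p" "q = p ^ e"
    using q by (auto simp: primepow_def)
  have "(\<Sum>x\<in>UNIV. x + 1 :: 'a) = (\<Sum>x\<in>UNIV. x)"
    by (rule sum.reindex_bij_witness[of _ "\<lambda>x. x - 1" "\<lambda>x. x + 1"]) auto
  hence "of_nat CARD('a) = (0 :: 'a)"
    by (simp add: sum.distrib)
  hence "CHAR('a) dvd CARD('a)"
    by (simp only: of_nat_eq_0_iff_char_dvd)
  hence "CHAR('a) dvd p ^ (e * n)"
    by (simp add: card p power_mult)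
  hence "CHAR('a) = p"
    using p(1) by (metis CHAR_prime prime_dvd_power primes_dvd_imp_eq)
  hence "q ^ d = CHAR('a) ^ (e * d)"
    by (simp add: p power_mult)
  hence sub: "is_subfield {x :: 'a. x ^ (q ^ d) = x}"
    by (rule is_subfield_fixed_points)
  have "q > 1"
    using primepow_gt_Suc_0[OF q] by simp
  hence crd: "card {x :: 'a. x ^ (q ^ d) = x} = q ^ d"
    using card d by (intro card_fixed_points) auto
  have uniq: "K = {x :: 'a. x ^ (q ^ d) = x}" if "is_subfield K \<and> card K = q ^ d" for K
    using that is_subfield_power_card[of K] crd by (intro card_subset_eq) auto
  show "\<exists>!K :: 'a set. is_subfield K \<and> card K = q ^ d"
    using sub crd uniq by blast
  show "subfield_of_card (q ^ d) = {x :: 'a. x ^ (q ^ d) = x}"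
    unfolding subfield_of_card_def
  proof (rule the_equality)
    show "is_subfield {x :: 'a. x ^ (q ^ d) = x} \<and> card {x :: 'a. x ^ (q ^ d) = x} = q ^ d"
      using sub crd ..
  qed (rule uniq)
qed

end

theory Submission
  imports
    Defs
    Complex_Main
    "HOL-Number_Theory.Cong"
    "HOL-Algebra.Algebraic_Closure_Type"
begin

text \<open>
  Let \<open>N\<close> be the least common multiple of the \<open>d\<^sub>i\<close> and \<open>Q = q ^ N\<close>. The \<open>a\<^sub>i\<close> determine a family of
  elements, compatible under traces, that is indexed by all divisors of the \<open>d\<^sub>i\<close>. This family
  is extended, one divisor at a time, to all divisors of \<open>N\<close>, so that some \<open>\<beta> \<in> \<F>\<^bsub>Q\<^esub>\<close> has the
  traces \<open>a\<^sub>i\<close>. As no \<open>d\<^sub>i\<close> equals \<open>N\<close>, adding a nonzero element all of whose traces to proper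
  subfields vanish we may assume \<open>\<beta> \<noteq> 0\<close>. It remains to find a primitive \<open>\<alpha>\<close> with \<open>Tr\<^bsub>n/N\<^esub>(\<alpha>) = \<beta>\<close>.

  For a multiplicative character \<open>\<chi>\<close> the sum of \<open>\<chi>\<close> over the fibre of the trace over \<open>\<beta>\<close> has the same
  absolute value for all \<open>\<beta> \<noteq> 0\<close>, so a second moment computation bounds it by the square root \<open>E\<close> of
  the size \<open>q ^ (n - N)\<close> of the fibre. A sieve over the primes dividing \<open>q ^ n - 1 < E ^ 4\<close> then
  yields \<open>\<alpha>\<close> whenever \<open>E \<ge> 330\<close>. Since \<open>N\<close> has two incomparable divisors, it is at least 6 and not a
  prime power, which leaves ten triples \<open>(q, N, n)\<close>. For these the prime factors of \<open>q ^ n - 1\<close> are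
  known explicitly.
\<close>
hide_const (open) Divisibility.prime

section \<open>Traces between subfields\<close>

text \<open>Translation by 1 permutes the field, so \<open>CARD('a)\<close> vanishes in it and the
  characteristic divides \<open>p ^ k\<close>.\<close>

lemma CHAR_eq_prime:
  assumes "prime p" and "CARD('a :: finite_field) = p ^ k"
  shows   "CHAR('a) = p"
proof -
  have "(\<Sum>x\<in>UNIV. x + 1 :: 'a) = (\<Sum>x\<in>UNIV. x)"
    by (rule sum.reindex_bij_witness[of _ "\<lambda>x. x - 1" "\<lambda>x. x + 1"]) auto
  hence "of_nat CARD('a) = (0 :: 'a)"
    by (simp add: sum.distrib)
  hence "CHAR('a) dvd p ^ k"
    by (simp only: of_nat_eq_0_iff_char_dvd assms)
  thus ?thesis
    using assms(1) by (metis CHAR_prime prime_dvd_power primes_dvd_imp_eq)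
qed

lemma sum_mult_coprime_mod:
  fixes f :: "nat \<Rightarrow> 'b :: comm_monoid_add"
  assumes "coprime u p" and "p > 0" and periodic: "\<And>i. f (i mod p) = f i"
  shows   "(\<Sum>i<p. f (u * i)) = (\<Sum>i<p. f i)"
proof -
  have inj: "inj_on (\<lambda>i. u * i mod p) {..<p}"
  proof (rule inj_onI)
    fix i j
    assume ij: "i \<in> {..<p}" "j \<in> {..<p}" "u * i mod p = u * j mod p"
    hence "[u * i = u * j] (mod p)"
      by (simp add: cong_def)
    hence "[i = j] (mod p)"
      using assms(1) by (simp add: cong_mult_lcancel_nat)
    thus "i = j"
      using ij by (simp add: cong_def)
  qed
  moreover have "(\<lambda>i. u * i mod p) ` {..<p} \<subseteq> {..<p}"
    using \<open>p > 0\<close> by auto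
  ultimately have "(\<lambda>i. u * i mod p) ` {..<p} = {..<p}"
    by (intro endo_inj_surj) auto
  hence "(\<Sum>i<p. f i) = (\<Sum>i\<in>(\<lambda>i. u * i mod p) ` {..<p}. f i)"
    by simp
  also have "\<dots> = (\<Sum>i<p. f (u * i))"
    by (simp add: sum.reindex[OF inj] periodic)
  finally show ?thesis ..
qed

lemma sum_lessThan_mult:
  fixes f :: "nat \<Rightarrow> 'b :: comm_monoid_add"
  shows "(\<Sum>j<b. \<Sum>i<a. f (i + j * a)) = (\<Sum>i<b * a. f i)"
proof -
  have "(\<Sum>i<a. f (i + j * a)) = sum f {j * a..<j * a + a}" for j
    using sum.shift_bounds_nat_ivl[of f 0 "j * a" a] by (simp add: atLeast0LessThan add.commute)
  thus ?thesis
    by (simp add: sum.nat_group)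
qed

locale finite_field_tower =
  fixes q n :: nat and F :: "'a :: finite_field itself"
  assumes q: "primepow q" and card: "CARD('a) = q ^ n" and n_pos: "n > 0"
begin

text \<open>Fixed points of a Frobenius power, so that membership is an equation. For
  \<open>e dvd n\<close> this is the subfield with \<open>q ^ e\<close> elements.\<close>

definition K :: "nat \<Rightarrow> 'a set" where
  "K e = {x. x ^ (q ^ e) = x}"

abbreviation Tr :: "nat \<Rightarrow> nat \<Rightarrow> 'a \<Rightarrow> 'a" where
  "Tr \<equiv> field_trace q"

lemma q_gt_1: "q > 1"
  using primepow_gt_Suc_0[OF q] by simp

lemma dvd_n_pos: "d dvd n \<Longrightarrow> d > 0"
  using n_pos by (auto intro: Nat.gr0I)

lemma q_eq_CHAR_power: "\<exists>e. q = CHAR('a) ^ e"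
proof -
  obtain p e where p: "prime p" "q = p ^ e"
    using q by (auto simp: primepow_def)
  have "CHAR('a) = p"
    using p card by (intro CHAR_eq_prime[of _ "e * n"]) (simp_all add: power_mult)
  thus ?thesis
    using p by auto
qed

lemma frob_add: "(x + y :: 'a) ^ (q ^ j) = x ^ (q ^ j) + y ^ (q ^ j)"
proof -
  obtain e where "q = CHAR('a) ^ e"
    using q_eq_CHAR_power by blast
  hence "q ^ j = CHAR('a) ^ (e * j)"
    by (simp add: power_mult)
  thus ?thesis
    by (intro freshmans_dream') simp_all
qed

lemma frob_sum: "(\<Sum>x\<in>A. f x :: 'a) ^ (q ^ j) = (\<Sum>x\<in>A. f x ^ (q ^ j))"
  using q_gt_1 by (induction A rule: infinite_finite_induct) (auto simp: frob_add power_0_left)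

lemma frob_diff: "(x - y :: 'a) ^ (q ^ j) = x ^ (q ^ j) - y ^ (q ^ j)"
  using frob_add[of "x - y" y j] by (simp add: algebra_simps)

lemma frob_frob: "((x :: 'a) ^ (q ^ i)) ^ (q ^ j) = x ^ (q ^ (i + j))"
  by (simp add: power_add flip: power_mult)

lemma K_n: "K n = UNIV"
  using finite_field_power_card_eq_same[where 'a = 'a] by (auto simp: K_def card)

lemma card_K: "d dvd n \<Longrightarrow> card (K d) = q ^ d"
  unfolding K_def using card_fixed_points[OF card q_gt_1 dvd_n_pos] by simp

lemma K_0 [simp]: "0 \<in> K e" and K_1 [simp]: "1 \<in> K e"
  using q_gt_1 by (auto simp: K_def)

lemma K_add: "x \<in> K e \<Longrightarrow> y \<in> K e \<Longrightarrow> x + y \<in> K e"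
  and K_diff: "x \<in> K e \<Longrightarrow> y \<in> K e \<Longrightarrow> x - y \<in> K e"
  and K_mult: "x \<in> K e \<Longrightarrow> y \<in> K e \<Longrightarrow> x * y \<in> K e"
  and K_divide: "x \<in> K e \<Longrightarrow> y \<in> K e \<Longrightarrow> x / y \<in> K e"
  by (simp_all add: K_def frob_add frob_diff power_mult_distrib power_divide)

lemma K_prod: "(\<And>i. i \<in> A \<Longrightarrow> f i \<in> K e) \<Longrightarrow> prod f A \<in> K e"
  by (induction A rule: infinite_finite_induct) (auto intro: K_mult)

lemma K_frob_mult: "x \<in> K e \<Longrightarrow> x ^ (q ^ (e * i)) = x"
  by (induction i) (simp_all add: K_def power_add power_mult)

lemma K_mono: "d dvd e \<Longrightarrow> x \<in> K d \<Longrightarrow> x \<in> K e"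
  using K_frob_mult[of x d "e div d"] by (simp add: K_def)

lemma K_frob_mod: "x \<in> K e \<Longrightarrow> x ^ (q ^ (j mod e)) = x ^ (q ^ j)"
  using frob_frob[of x "e * (j div e)" "j mod e"] K_frob_mult[of x e "j div e"] by simp

lemma Tr_0 [simp]: "Tr m d 0 = 0"
  using q_gt_1 by (simp add: field_trace_def power_0_left)

lemma Tr_add: "Tr m d (x + y) = Tr m d x + Tr m d y"
  by (simp add: field_trace_def frob_add sum.distrib)

lemma Tr_diff: "Tr m d (x - y) = Tr m d x - Tr m d y"
  by (simp add: field_trace_def frob_diff sum_subtractf)

lemma Tr_mult_left: "c \<in> K d \<Longrightarrow> Tr m d (c * x) = c * Tr m d x"
  by (simp add: field_trace_def power_mult_distrib K_frob_mult sum_distrib_left)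

lemma Tr_mult_right: "c \<in> K d \<Longrightarrow> Tr m d (x * c) = Tr m d x * c"
  using Tr_mult_left[of c d m x] by (simp add: mult.commute)

lemma Tr_self: "d > 0 \<Longrightarrow> Tr d d x = x"
  by (simp add: field_trace_def)

text \<open>Raising to the power \<open>q ^ d\<close> shifts the summation index by one; the last
  term wraps around to \<open>x\<close> because \<open>x \<in> K m\<close>.\<close>

lemma Tr_in_K:
  assumes "x \<in> K m" and "d dvd m" and "m > 0"
  shows   "Tr m d x \<in> K d"
proof -
  obtain c where c: "m = d * c" "c > 0" "d > 0"
    using assms by (auto elim!: dvdE)
  have "Tr m d x ^ (q ^ d) = (\<Sum>i<c. x ^ (q ^ (d * Suc i)))"
    using c by (simp add: field_trace_def frob_sum frob_frob add.commute)
  also have "\<dots> = (\<Sum>i<Suc c. x ^ (q ^ (d * i))) - x"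
    by (simp only: sum.lessThan_Suc_shift) simp
  also have "\<dots> = Tr m d x"
    using c K_frob_mult[OF assms(1), of 1] by (simp add: field_trace_def)
  finally show ?thesis
    by (simp add: K_def)
qed

lemma Tr_trans:
  assumes "e dvd d" and "d dvd m" and "m > 0"
  shows   "Tr d e (Tr m d x) = Tr m e x"
proof -
  obtain a b where a: "d = e * a" and b: "m = d * b"
    using assms by (auto elim!: dvdE)
  have pos: "a > 0" "b > 0" "e > 0"
    using assms a b by auto
  have "Tr d e (Tr m d x) = (\<Sum>i<a. \<Sum>j<b. x ^ (q ^ (e * (i + j * a))))"
    using a b pos by (simp add: field_trace_def frob_sum frob_frob algebra_simps)
  also have "\<dots> = (\<Sum>i<b * a. x ^ (q ^ (e * i)))"
    using sum_lessThan_mult[of "\<lambda>i. x ^ (q ^ (e * i))" a b] by (subst sum.swap) simp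
  also have "\<dots> = Tr m e x"
    using a b pos by (simp add: field_trace_def mult_ac)
  finally show ?thesis .
qed

text \<open>On \<open>K (p * f)\<close> the map \<open>x ^ (q ^ f)\<close> has order dividing
  \<open>p\<close>. Since \<open>u\<close> is a unit modulo \<open>p\<close>, steps of length
  \<open>f * u\<close> run through the same conjugates as steps of length \<open>f\<close>.\<close>

lemma Tr_coprime_extension:
  assumes "x \<in> K (p * f)" and "coprime u p" and "p > 0" "f > 0" "u > 0"
  shows   "Tr (p * f * u) (f * u) x = Tr (p * f) f x"
proof -
  have "(\<Sum>i<p. x ^ (q ^ (f * (u * i)))) = (\<Sum>i<p. x ^ (q ^ (f * i)))"
  proof (rule sum_mult_coprime_mod[OF assms(2,3)])
    fix i
    have "f * (i mod p) = (f * i) mod (p * f)"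
      using mult_mod_right[of f i p] by (metis mult.commute)
    thus "x ^ (q ^ (f * (i mod p))) = x ^ (q ^ (f * i))"
      using K_frob_mod[OF assms(1), of "f * i"] by (simp only:)
  qed
  moreover have "p * f * u div (f * u) = p" "p * f div f = p"
    using assms by simp_all
  ultimately show ?thesis
    by (simp add: field_trace_def mult_ac)
qed

text \<open>A fibre consists of roots of a polynomial of degree at most \<open>q ^ (m - d)\<close>.
  The \<open>q ^ d\<close> fibres partition the \<open>q ^ m\<close> elements of \<open>K m\<close>,
  so all attain this bound and none is empty.\<close>

lemma Tr_image_fibre:
  assumes "m dvd n" "d dvd m"
  shows   "b \<in> K d \<Longrightarrow> card {x \<in> K m. Tr m d x = b} = q ^ (m - d)"
    and   "Tr m d ` K m = K d"
proof -
  obtain c where c: "m = d * c" "c > 0" "d > 0"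
    using assms n_pos by (auto elim!: dvdE)
  define P where "P b = (\<Sum>i<c. Polynomial.monom (1 :: 'a) (q ^ (d * i))) - [:b:]" for b
  have inj: "d * i = d * j \<longleftrightarrow> i = j" for i j
    using c by simp
  \<comment> \<open>The exponents are distinct and positive, so neither another monomial nor the
    constant \<open>b\<close> meets the top coefficient.\<close>
  have "poly.coeff (P b) (q ^ (d * (c - 1))) = (\<Sum>i<c. if i = c - 1 then 1 else 0) " for b
  proof -
    have "q ^ (d * (c - 1)) \<noteq> 0"
      using q_gt_1 by simp
    hence "poly.coeff [:b:] (q ^ (d * (c - 1))) = 0"
      by (cases "q ^ (d * (c - 1))") (simp_all add: coeff_pCons)
    thus ?thesis
      using q_gt_1 c unfolding P_def coeff_diff coeff_sum by (simp add: inj)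
  qed
  hence "poly.coeff (P b) (q ^ (d * (c - 1))) = 1" for b
    using c by simp
  hence nz: "P b \<noteq> 0" for b
    by (metis coeff_0 zero_neq_one)
  have deg: "Polynomial.degree (P b) \<le> q ^ (m - d)" for b
  proof -
    have "d * i \<le> m - d" if "i < c" for i
      using that c mult_le_mono2[of i "c - 1" d] by (simp add: diff_mult_distrib2)
    hence "Polynomial.degree (Polynomial.monom (1 :: 'a) (q ^ (d * i))) \<le> q ^ (m - d)" if "i < c" for i
      using that q_gt_1 by (intro order.trans[OF degree_monom_le] power_increasing) auto
    thus ?thesis
      unfolding P_def by (intro degree_diff_le degree_sum_le) auto
  qed
  have poly: "poly (P b) x = Tr m d x - b" for b x
    using c by (simp add: P_def poly_sum poly_monom field_trace_def)
  have le: "card {x \<in> K m. Tr m d x = b} \<le> q ^ (m - d)" for b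
  proof -
    have "card {x \<in> K m. Tr m d x = b} \<le> card {x. poly (P b) x = 0}"
      by (intro card_mono) (auto simp: poly)
    also have "\<dots> \<le> q ^ (m - d)"
      using card_poly_roots_bound[OF nz] deg by (rule order.trans)
    finally show ?thesis .
  qed
  have "m > 0"
    using c by simp
  have "card (\<Union>b\<in>K d. {x \<in> K m. Tr m d x = b}) = (\<Sum>b\<in>K d. card {x \<in> K m. Tr m d x = b})"
    by (rule card_UN_disjoint) auto
  also have "(\<Union>b\<in>K d. {x \<in> K m. Tr m d x = b}) = K m"
    using Tr_in_K[OF _ assms(2) \<open>m > 0\<close>] by auto
  finally have tot: "(\<Sum>b\<in>K d. card {x \<in> K m. Tr m d x = b}) = q ^ m"
    using assms by (simp add: card_K)
  have "card (K d) * q ^ (m - d) = q ^ m"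
    using c assms dvd_trans[OF assms(2,1)] by (simp add: card_K flip: power_add)
  hence tot': "(\<Sum>b\<in>K d. q ^ (m - d)) = q ^ m"
    by simp
  show eq: "card {x \<in> K m. Tr m d x = b} = q ^ (m - d)" if "b \<in> K d" for b
  proof (rule ccontr)
    assume "card {x \<in> K m. Tr m d x = b} \<noteq> q ^ (m - d)"
    hence "card {x \<in> K m. Tr m d x = b} < q ^ (m - d)"
      using le[of b] by simp
    hence "(\<Sum>b\<in>K d. card {x \<in> K m. Tr m d x = b}) < (\<Sum>b\<in>K d. q ^ (m - d))"
      by (intro sum_strict_mono_ex1) (use that le in auto)
    thus False
      using tot tot' by simp
  qed
  show "Tr m d ` K m = K d"
  proof
    show "Tr m d ` K m \<subseteq> K d"
      using Tr_in_K[OF _ assms(2) \<open>m > 0\<close>] by auto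
    show "K d \<subseteq> Tr m d ` K m"
    proof
      fix b
      assume "b \<in> K d"
      hence "card {x \<in> K m. Tr m d x = b} > 0"
        using eq q_gt_1 by simp
      thus "b \<in> Tr m d ` K m"
        by (auto simp: card_gt_0_iff)
    qed
  qed
qed

end

section \<open>Elements with prescribed traces\<close>

context finite_field_tower begin

text \<open>Elements of \<open>K (p ^ Suc v)\<close> lie in \<open>K (e div r)\<close> for every
  prime \<open>r \<noteq> p\<close> dividing \<open>e\<close>. This makes the choices for different
  primes independent.\<close>

lemma prime_power_part:
  assumes "prime p" "p dvd e" "e dvd n"
  obtains v u where "e = p ^ Suc v * u" "coprime u p" "u > 0" "p ^ Suc v dvd n"
    "\<And>r. prime r \<Longrightarrow> r dvd e \<Longrightarrow> r \<noteq> p \<Longrightarrow> p ^ Suc v dvd e div r"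
proof -
  have "e > 0" "\<not> is_unit p"
    using assms dvd_n_pos by (auto dest: not_prime_unit)
  then obtain u where u: "e = p ^ multiplicity p e * u" "\<not> p dvd u"
    by (metis multiplicity_decompose' not_gr_zero)
  define v where "v = multiplicity p e - 1"
  have "multiplicity p e > 0"
    using assms \<open>e > 0\<close> by (simp add: prime_multiplicity_gt_zero_iff)
  hence v: "Suc v = multiplicity p e"
    by (simp add: v_def)
  have *: "p ^ Suc v dvd e div r" if r: "prime r" "r dvd e" "r \<noteq> p" for r
  proof -
    have "coprime r (p ^ Suc v)"
      using r assms(1) by (simp add: primes_coprime)
    moreover have "p ^ Suc v dvd e"
      using u(1) unfolding v by (metis dvd_triv_left)
    hence "p ^ Suc v dvd r * (e div r)"
      using r by simp
    ultimately show ?thesis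
      by (metis coprime_commute coprime_dvd_mult_right_iff)
  qed
  show ?thesis
  proof (rule that[of v u])
    show "e = p ^ Suc v * u" "u > 0"
      using u(1) \<open>e > 0\<close> unfolding v by (auto intro: Nat.gr0I)
    show "coprime u p"
      using u(2) assms(1) by (metis coprime_commute prime_imp_coprime)
    show "p ^ Suc v dvd n"
      using u(1) assms(3) unfolding v by (metis dvd_trans dvd_triv_left)
  qed (rule *)
qed

lemma Tr_div_prime_eq:
  assumes "e dvd n" "e = p ^ Suc v * u" "coprime u p" "x \<in> K (p ^ Suc v)"
  shows   "Tr e (e div p) x = Tr (p ^ Suc v) (p ^ v) x"
proof -
  have "p > 0" "u > 0"
    using assms dvd_n_pos[of e] by (auto intro: Nat.gr0I)
  thus ?thesis
    using Tr_coprime_extension[of x p "p ^ v" u] assms by simp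
qed

text \<open>\<open>\<theta>\<close> comes from the subfield of the \<open>p\<close>-part of
  \<open>e\<close>, where the trace of degree \<open>p\<close> is onto and agrees with the trace
  from \<open>e\<close> to \<open>e div p\<close>.\<close>

lemma exists_trace_one_prime_part:
  assumes "prime p" "p dvd e" "e dvd n"
  obtains \<theta> where "\<theta> \<in> K e" "Tr e (e div p) \<theta> = 1"
    "\<And>r. prime r \<Longrightarrow> r dvd e \<Longrightarrow> r \<noteq> p \<Longrightarrow> \<theta> \<in> K (e div r)"
proof -
  obtain v u where vu: "e = p ^ Suc v * u" "coprime u p" "u > 0" "p ^ Suc v dvd n"
    "\<And>r. prime r \<Longrightarrow> r dvd e \<Longrightarrow> r \<noteq> p \<Longrightarrow> p ^ Suc v dvd e div r"
    using prime_power_part[OF assms] by blast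
  have "1 \<in> Tr (p ^ Suc v) (p ^ v) ` K (p ^ Suc v)"
    by (subst Tr_image_fibre(2)) (use vu in auto)
  then obtain \<theta> where \<theta>: "\<theta> \<in> K (p ^ Suc v)" "Tr (p ^ Suc v) (p ^ v) \<theta> = 1"
    by auto
  show ?thesis
    using that[of \<theta>] \<theta> vu Tr_div_prime_eq[OF assms(3) vu(1,2)] K_mono
    by (metis dvd_triv_left)
qed

lemma exists_trace_zero_prime_part:
  assumes "prime p" "p dvd e" "e dvd n"
  obtains \<nu> where "\<nu> \<in> K e" "\<nu> \<noteq> 0" "Tr e (e div p) \<nu> = 0"
    "\<And>r. prime r \<Longrightarrow> r dvd e \<Longrightarrow> r \<noteq> p \<Longrightarrow> \<nu> \<in> K (e div r)"
proof -
  obtain v u where vu: "e = p ^ Suc v * u" "coprime u p" "u > 0" "p ^ Suc v dvd n"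
    "\<And>r. prime r \<Longrightarrow> r dvd e \<Longrightarrow> r \<noteq> p \<Longrightarrow> p ^ Suc v dvd e div r"
    using prime_power_part[OF assms] by blast
  have "p ^ v < p ^ Suc v"
    using prime_gt_1_nat[OF assms(1)] by simp
  hence "1 < q ^ (p ^ Suc v - p ^ v)"
    by (intro one_less_power q_gt_1) simp
  also have "\<dots> = card {x \<in> K (p ^ Suc v). Tr (p ^ Suc v) (p ^ v) x = 0}" (is "_ = card ?Z")
    by (rule Tr_image_fibre(1)[symmetric]) (use vu in auto)
  finally have "\<not> ?Z \<subseteq> {0}"
    using card_mono[of "{0}" ?Z] by fastforce
  then obtain \<nu> where \<nu>: "\<nu> \<in> K (p ^ Suc v)" "Tr (p ^ Suc v) (p ^ v) \<nu> = 0" "\<nu> \<noteq> 0"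
    by auto
  show ?thesis
    using that[of \<nu>] \<nu> vu Tr_div_prime_eq[OF assms(3) vu(1,2)] K_mono
    by (metis dvd_triv_left)
qed

lemma proper_dvd_div_prime:
  assumes "f dvd e" "f \<noteq> e" "e > (0 :: nat)"
  obtains p where "prime p" "p dvd e" "f dvd e div p"
proof -
  obtain c where c: "e = f * c"
    using assms by auto
  hence "c \<noteq> 1"
    using assms by auto
  then obtain p where "prime p" "p dvd c"
    by (metis prime_factor_nat)
  thus ?thesis
    using that[of p] c by (auto elim!: dvdE)
qed

text \<open>The traces to the maximal subfields commute with multiplication by the \<open>\<nu>\<^sub>r\<close> for the other
  primes \<open>r\<close>, so the product of all \<open>\<nu>\<^sub>p\<close> is killed by each of them.\<close>
lemma exists_nonzero_traces_zero:
  assumes "e dvd n"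
  obtains \<nu> where "\<nu> \<in> K e" "\<nu> \<noteq> 0" "\<And>f. f dvd e \<Longrightarrow> f \<noteq> e \<Longrightarrow> Tr e f \<nu> = 0"
proof -
  have "e > 0"
    using assms dvd_n_pos by blast
  have "\<exists>\<nu>. \<nu> \<in> K e \<and> \<nu> \<noteq> 0 \<and> Tr e (e div p) \<nu> = 0
     \<and> (\<forall>r. prime r \<longrightarrow> r dvd e \<longrightarrow> r \<noteq> p \<longrightarrow> \<nu> \<in> K (e div r))" if "p \<in> prime_factors e" for p
    by (rule exists_trace_zero_prime_part[of p e]) (use that assms in auto)
  then obtain w where w: "\<And>p. p \<in> prime_factors e \<Longrightarrow> w p \<in> K e \<and> w p \<noteq> 0
     \<and> Tr e (e div p) (w p) = 0 \<and> (\<forall>r. prime r \<longrightarrow> r dvd e \<longrightarrow> r \<noteq> p \<longrightarrow> w p \<in> K (e div r))"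
    by metis
  define \<nu> where "\<nu> = (\<Prod>p\<in>prime_factors e. w p)"
  have Tr0: "Tr e (e div p) \<nu> = 0" if p: "p \<in> prime_factors e" for p
  proof -
    have "(\<Prod>r\<in>prime_factors e - {p}. w r) \<in> K (e div p)"
      by (intro K_prod) (use w p in auto)
    moreover have "\<nu> = w p * (\<Prod>r\<in>prime_factors e - {p}. w r)"
      unfolding \<nu>_def by (rule prod.remove) (use p in auto)
    ultimately show ?thesis
      using w p by (simp add: Tr_mult_right)
  qed
  show ?thesis
  proof (rule that[of \<nu>])
    show "\<nu> \<in> K e"
      unfolding \<nu>_def using w by (intro K_prod) auto
    show "\<nu> \<noteq> 0"
      using w by (simp add: \<nu>_def)
    fix f
    assume f: "f dvd e" "f \<noteq> e"
    then obtain p where p: "prime p" "p dvd e" "f dvd e div p"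
      using proper_dvd_div_prime \<open>e > 0\<close> by blast
    have "Tr e f \<nu> = Tr (e div p) f (Tr e (e div p) \<nu>)"
      using p \<open>e > 0\<close> by (intro Tr_trans[symmetric]) (auto simp: div_dvd_iff_mult)
    thus "Tr e f \<nu> = 0"
      using Tr0[of p] p \<open>e > 0\<close> by (simp add: prime_factors_dvd)
  qed
qed

text \<open>Over \<open>K (e div (p * r))\<close> the fields \<open>K (e div p)\<close> and
  \<open>K (e div r)\<close> have the coprime degrees \<open>r\<close> and \<open>p\<close>.\<close>

lemma Tr_commute_prime:
  assumes "prime p" "prime r" "p \<noteq> r" "p dvd e" "r dvd e" "e > 0" "x \<in> K (e div p)"
  shows   "Tr e (e div r) x = Tr (e div p) (e div (p * r)) x"
proof -
  have "coprime p r"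
    using assms by (simp add: primes_coprime)
  hence "p * r dvd e"
    using assms by (simp add: divides_mult)
  then obtain f where "e = p * r * f" ..
  hence f: "e = r * f * p"
    by (simp add: mult_ac)
  moreover have "p > 0" "r > 0" "f > 0"
    using assms f by (auto simp: prime_gt_0_nat)
  ultimately show ?thesis
    using Tr_coprime_extension[of x r f p] \<open>coprime p r\<close> assms(7) by (simp add: mult_ac)
qed

text \<open>As in interpolation, the primes are treated one by one. Adding
  \<open>c * \<theta>\<close> repairs the trace at \<open>p\<close>, where \<open>\<theta>\<close>
  has trace 1. At the earlier primes \<open>\<theta>\<close> is a scalar and \<open>c\<close> has
  trace 0 by compatibility, so nothing changes there.\<close>

lemma exists_prescribed_maximal_traces:
  assumes e: "e dvd n"
    and a: "\<And>p. prime p \<Longrightarrow> p dvd e \<Longrightarrow> a p \<in> K (e div p)"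
    and comp: "\<And>p r. prime p \<Longrightarrow> prime r \<Longrightarrow> p dvd e \<Longrightarrow> r dvd e \<Longrightarrow> p \<noteq> r \<Longrightarrow>
       Tr (e div p) (e div (p * r)) (a p) = Tr (e div r) (e div (p * r)) (a r)"
  shows "\<exists>b\<in>K e. \<forall>p. prime p \<longrightarrow> p dvd e \<longrightarrow> Tr e (e div p) b = a p"
proof -
  have "e > 0"
    using e dvd_n_pos by blast
  have "\<exists>b\<in>K e. \<forall>p\<in>P. Tr e (e div p) b = a p" if "finite P" "P \<subseteq> prime_factors e" for P
    using that
  proof (induction P rule: finite_induct)
    case empty
    show ?case
      using K_0 by blast
  next
    case (insert p P)
    then obtain b where b: "b \<in> K e" "\<forall>r\<in>P. Tr e (e div r) b = a r"
      by auto
    have p: "prime p" "p dvd e"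
      using insert.prems by auto
    obtain \<theta> where \<theta>: "\<theta> \<in> K e" "Tr e (e div p) \<theta> = 1"
      "\<And>r. prime r \<Longrightarrow> r dvd e \<Longrightarrow> r \<noteq> p \<Longrightarrow> \<theta> \<in> K (e div r)"
      using exists_trace_one_prime_part[OF p e] by blast
    define c where "c = a p - Tr e (e div p) b"
    have div: "e div r dvd e" if "r dvd e" for r
      using that by auto
    have c: "c \<in> K (e div p)"
      unfolding c_def using a[OF p] Tr_in_K[OF b(1) div[OF p(2)] \<open>e > 0\<close>] by (rule K_diff)
    show ?case
    proof (intro bexI[of _ "b + c * \<theta>"] ballI)
      show "b + c * \<theta> \<in> K e"
        using b c \<theta> K_mono[OF div[OF p(2)]] by (intro K_add K_mult) auto
      fix r
      assume "r \<in> insert p P"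
      moreover have "Tr e (e div p) (b + c * \<theta>) = a p"
        using Tr_mult_left[OF c] \<theta>(2) by (simp add: Tr_add c_def)
      moreover have "Tr e (e div r) (b + c * \<theta>) = a r" if "r \<in> P"
      proof -
        have r: "prime r" "r dvd e" "r \<noteq> p"
          using insert that by auto
        have "p * r dvd e"
          using p r by (simp add: divides_mult primes_coprime)
        hence d: "e div (p * r) dvd e div p" "e div (p * r) dvd e div r"
          using \<open>e > 0\<close> by (auto elim!: dvdE simp: mult_ac)
        have "Tr e (e div r) c = Tr (e div p) (e div (p * r)) c"
          using p r \<open>e > 0\<close> c by (intro Tr_commute_prime) auto
        also have "\<dots> = Tr (e div p) (e div (p * r)) (a p) - Tr e (e div (p * r)) b"
          unfolding c_def Tr_diff using Tr_trans[OF d(1) div[OF p(2)] \<open>e > 0\<close>] by simp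
        also have "Tr e (e div (p * r)) b = Tr (e div r) (e div (p * r)) (a r)"
          using Tr_trans[OF d(2) div[OF r(2)] \<open>e > 0\<close>] b that by metis
        finally have "Tr e (e div r) c = 0"
          using comp[of p r] p r by simp
        thus ?thesis
          using b that \<theta>(3)[OF r] by (simp add: Tr_add Tr_mult_right)
      qed
      ultimately show "Tr e (e div r) (b + c * \<theta>) = a r"
        by blast
    qed
  qed
  from this[of "prime_factors e"] show ?thesis
    using \<open>e > 0\<close> by (auto simp: prime_factors_dvd)
qed

text \<open>A compatible family on a down-closed set of divisors of \<open>N\<close> is extended one divisor at a
  time, so that only the maximal subfields of a single field have to be considered.\<close>
lemma exists_prescribed_traces:
  assumes "N dvd n" and "D \<subseteq> {f. f dvd N}"
    and "\<And>e f. e \<in> D \<Longrightarrow> f dvd e \<Longrightarrow> f \<in> D"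
    and "\<And>e. e \<in> D \<Longrightarrow> a e \<in> K e"
    and "\<And>e f. e \<in> D \<Longrightarrow> f dvd e \<Longrightarrow> Tr e f (a e) = a f"
  shows "\<exists>b\<in>K N. \<forall>e\<in>D. Tr N e b = a e"
  using assms(2-)
proof (induction "card ({f. f dvd N} - D)" arbitrary: D a rule: less_induct)
  case less
  note D = less.prems(1) and down = less.prems(2) and aK = less.prems(3) and aTr = less.prems(4)
  have "N > 0"
    using assms(1) dvd_n_pos by blast
  show ?case
  proof (cases "N \<in> D")
    case True
    thus ?thesis
      using aK aTr D by (intro bexI[of _ "a N"]) auto
  next
    case False
    \<comment> \<open>Minimality puts all proper divisors of \<open>e\<close> into \<open>D\<close>,
      so the traces wanted at \<open>e\<close> are already given.\<close>
    define e where "e = (LEAST e. e dvd N \<and> e \<notin> D)"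
    have e: "e dvd N" "e \<notin> D"
      using LeastI[of "\<lambda>e. e dvd N \<and> e \<notin> D" N] False by (simp_all add: e_def)
    have "e > 0" "e dvd n"
      using e \<open>N > 0\<close> assms(1) by (auto intro: Nat.gr0I dvd_trans)
    have small: "f \<in> D" if "f dvd e" "f \<noteq> e" for f
      using that e not_less_Least[of f "\<lambda>e. e dvd N \<and> e \<notin> D"] dvd_imp_le[of f e] \<open>e > 0\<close>
      by (fastforce simp flip: e_def intro: dvd_trans)
    have div: "e div p \<in> D" "e div p dvd e" if "prime p" "p dvd e" for p
    proof -
      show "e div p dvd e"
        using that by auto
      moreover have "e div p \<noteq> e"
        using prime_gt_1_nat[OF that(1)] \<open>e > 0\<close> by (simp add: div_less_dividend less_imp_neq)
      ultimately show "e div p \<in> D"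
        by (rule small)
    qed
    have "\<exists>b\<in>K e. \<forall>p. prime p \<longrightarrow> p dvd e \<longrightarrow> Tr e (e div p) b = a (e div p)"
    proof (rule exists_prescribed_maximal_traces[OF \<open>e dvd n\<close>])
      show "a (e div p) \<in> K (e div p)" if "prime p" "p dvd e" for p
        using aK div that by blast
      fix p r :: nat
      assume pr: "prime p" "prime r" "p dvd e" "r dvd e" "p \<noteq> r"
      hence "p * r dvd e"
        by (simp add: divides_mult primes_coprime)
      hence "e div (p * r) dvd e div p" "e div (p * r) dvd e div r"
        using \<open>e > 0\<close> by (auto elim!: dvdE simp: mult_ac)
      thus "Tr (e div p) (e div (p * r)) (a (e div p)) = Tr (e div r) (e div (p * r)) (a (e div r))"
        using pr div aTr by simp
    qed
    then obtain b where b: "b \<in> K e" "\<And>p. prime p \<Longrightarrow> p dvd e \<Longrightarrow> Tr e (e div p) b = a (e div p)"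
      by blast
    have bTr: "Tr e f b = a f" if f: "f dvd e" "f \<noteq> e" for f
    proof -
      obtain p where p: "prime p" "p dvd e" "f dvd e div p"
        using proper_dvd_div_prime[OF f \<open>e > 0\<close>] by blast
      have "Tr e f b = Tr (e div p) f (Tr e (e div p) b)"
        using p div(2) \<open>e > 0\<close> by (intro Tr_trans[symmetric]) auto
      also have "\<dots> = a f"
        using p b(2) aTr[OF div(1) p(3)] by simp
      finally show ?thesis .
    qed
    have "\<exists>b'\<in>K N. \<forall>f\<in>insert e D. Tr N f b' = (a(e := b)) f"
    proof (rule less.hyps)
      have "{f. f dvd N} - insert e D \<subset> {f. f dvd N} - D"
        using e by auto
      thus "card ({f. f dvd N} - insert e D) < card ({f. f dvd N} - D)"
        using \<open>N > 0\<close> by (intro psubset_card_mono) auto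
      show "insert e D \<subseteq> {f. f dvd N}"
        using D e by auto
      show "f' \<in> insert e D" if "f \<in> insert e D" "f' dvd f" for f f'
        using that small down by blast
      show "(a(e := b)) f \<in> K f" if "f \<in> insert e D" for f
        using that aK b by auto
      show "Tr f f' ((a(e := b)) f) = (a(e := b)) f'" if "f \<in> insert e D" "f' dvd f" for f f'
        using that bTr Tr_self[OF \<open>e > 0\<close>] down[of f f'] aTr[of f f'] e(2) by auto
    qed
    then obtain b' where "b' \<in> K N" "\<And>f. f \<in> insert e D \<Longrightarrow> Tr N f b' = (a(e := b)) f"
      by blast
    thus ?thesis
      using e(2) by (intro bexI[of _ b']) fastforce+
  qed
qed

end

section \<open>Character sums over the fibres of the trace\<close>

text \<open>Transfers the cyclicity of the multiplicative group from ring records to the type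
  class.\<close>

lemma finite_field_generator:
  obtains g :: "'a :: finite_field" where "g \<noteq> 0" "\<And>x. x \<noteq> 0 \<Longrightarrow> \<exists>i. x = g ^ i"
proof -
  interpret R: Ring.field "ring_of_type_algebra :: 'a ring"
    by (rule field_from_type_algebra)
  have pow: "x [^]\<^bsub>(ring_of_type_algebra :: 'a ring)\<^esub> (i :: nat) = x ^ i" for x i
    by (induction i) (simp_all add: nat_pow_def ring_of_type_algebra_def)
  obtain g :: 'a where g: "g \<in> carrier (mult_of ring_of_type_algebra)"
    "carrier (mult_of ring_of_type_algebra) = {g [^]\<^bsub>(ring_of_type_algebra :: 'a ring)\<^esub> i | i::nat. i \<in> UNIV}"
    using R.finite_field_mult_group_has_gen by (auto simp: ring_of_type_algebra_def)
  show ?thesis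
  proof (rule that[of g])
    show "g \<noteq> 0"
      using g(1) by (simp add: ring_of_type_algebra_def)
    fix x :: 'a
    assume "x \<noteq> 0"
    hence "x \<in> carrier (mult_of ring_of_type_algebra)"
      by (simp add: ring_of_type_algebra_def)
    thus "\<exists>i. x = g ^ i"
      unfolding g(2) pow by auto
  qed
qed

text \<open>Characters are extended by 0 at 0, the trivial one included. That their values on units
  have absolute value 1 is a consequence.\<close>

definition mult_char :: "('a :: field \<Rightarrow> complex) \<Rightarrow> bool" where
  "mult_char h \<longleftrightarrow> h 0 = 0 \<and> h 1 = 1 \<and> (\<forall>x y. h (x * y) = h x * h y)"

lemma mult_char_power: "mult_char h \<Longrightarrow> h (x ^ k) = h x ^ k"
  by (induction k) (simp_all add: mult_char_def)

lemma norm_mult_char: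
  assumes "mult_char h" "x \<noteq> (0 :: 'a :: finite_field)"
  shows   "norm (h x) = 1"
proof -
  have "x * x ^ (CARD('a) - 1) = x ^ CARD('a)"
    using finite_UNIV_card_ge_0[where 'a = 'a] by (cases "CARD('a)") auto
  hence "x ^ (CARD('a) - 1) = 1"
    using assms(2) by (simp add: finite_field_power_card_eq_same)
  hence "norm (h x) ^ (CARD('a) - 1) = 1"
    using mult_char_power[OF assms(1), of x "CARD('a) - 1"] assms(1)
    by (simp add: mult_char_def flip: norm_power)
  moreover have "card {0, 1 :: 'a} \<le> CARD('a)"
    by (intro card_mono) auto
  ultimately show ?thesis
    using power_eq_1_iff[of "norm (h x)" "CARD('a) - 1"] by auto
qed

text \<open>Replacing \<open>y\<close> by \<open>x * y\<close> permutes the field but multiplies the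
  sum by \<open>h x\<close>.\<close>

lemma sum_mult_char:
  assumes "mult_char h" and "x \<noteq> (0 :: 'a :: finite_field)" "h x \<noteq> 1"
  shows   "(\<Sum>y\<in>UNIV. h y) = 0"
proof -
  have "(\<Sum>y\<in>UNIV. h y) = (\<Sum>y\<in>UNIV. h (x * y))"
    by (rule sum.reindex_bij_witness[of _ "\<lambda>y. x * y" "\<lambda>y. y / x"]) (use assms in auto)
  also have "\<dots> = h x * (\<Sum>y\<in>UNIV. h y)"
    using assms(1) by (simp add: mult_char_def sum_distrib_left)
  finally show ?thesis
    using assms(3) by simp
qed

context finite_field_tower begin

lemma card_traceless_multiples:
  assumes "d dvd n"
  shows   "card {y. y \<noteq> 0 \<and> Tr n d (t * y) = 0} = (if t = 0 then q ^ n else q ^ (n - d)) - 1"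
proof -
  have "{y. y \<noteq> 0 \<and> Tr n d (t * y) = 0} = {y. Tr n d (t * y) = 0} - {0}"
    by auto
  hence "card {y. y \<noteq> 0 \<and> Tr n d (t * y) = 0} = card {y. Tr n d (t * y) = 0} - 1"
    by (simp add: card_Diff_singleton)
  moreover have "card {y. Tr n d (t * y) = 0} = (if t = 0 then q ^ n else q ^ (n - d))"
  proof (cases "t = 0")
    case False
    have "card {y. Tr n d (t * y) = 0} = card {x. Tr n d x = 0}"
      by (rule bij_betw_same_card[of "\<lambda>y. t * y"])
         (rule bij_betw_byWitness[of _ "\<lambda>x. x / t"]; use False in auto)
    thus ?thesis
      using False Tr_image_fibre(1)[OF dvd_refl assms, of 0] by (simp add: K_n)
  qed (simp add: card)
  ultimately show ?thesis
    by simp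
qed

definition trace_char_sum :: "nat \<Rightarrow> ('a \<Rightarrow> complex) \<Rightarrow> 'a \<Rightarrow> complex" where
  "trace_char_sum d h b = (\<Sum>x | Tr n d x = b. h x)"

text \<open>Multiplication by \<open>c\<close> carries the fibre over \<open>b\<close> to the fibre
  over \<open>c * b\<close>.\<close>

lemma trace_char_sum_mult:
  assumes "mult_char h" "c \<in> K d" "c \<noteq> 0"
  shows   "trace_char_sum d h (c * b) = h c * trace_char_sum d h b"
proof -
  have "inverse c \<in> K d"
    using K_divide[OF K_1 assms(2)] by (simp add: field_simps)
  note inv = Tr_mult_left[OF this]
  have "trace_char_sum d h (c * b) = (\<Sum>x | Tr n d x = b. h (c * x))"
    unfolding trace_char_sum_def
    by (rule sum.reindex_bij_witness[of _ "\<lambda>x. c * x" "\<lambda>x. inverse c * x"])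
       (use assms inv in \<open>auto simp: Tr_mult_left simp flip: mult.assoc\<close>)
  thus ?thesis
    using assms(1) by (simp add: trace_char_sum_def mult_char_def sum_distrib_left)
qed

lemma sum_over_traces: "(\<Sum>b\<in>K d. \<Sum>x | Tr n d x = b. f x) = (\<Sum>x\<in>UNIV. f x)"
  if "d dvd n" for f :: "'a \<Rightarrow> 'b :: comm_monoid_add"
proof -
  have "Tr n d x \<in> K d" for x
    using Tr_in_K[of x n d] that n_pos by (simp add: K_n)
  thus ?thesis
    using sum.group[of UNIV "K d" "Tr n d" f] by auto
qed

text \<open>The second moment counts pairs \<open>(t y, y)\<close> with \<open>Tr ((t - 1) y) = 0\<close>.\<close>
lemma trace_char_sum_second_moment:
  assumes d: "d dvd n" and h: "mult_char h" and nontriv: "x \<noteq> 0" "h x \<noteq> 1"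
  shows   "(\<Sum>b\<in>K d. (norm (trace_char_sum d h b))\<^sup>2) = real (q ^ n) - real (q ^ (n - d))"
proof -
  let ?S = "trace_char_sum d h"
  define c where "c = complex_of_nat (q ^ (n - d) - 1)"
  have ineq: "1 \<le> q ^ (n - d)" "1 \<le> q ^ n"
    using q_gt_1 by simp_all
  have "complex_of_real (\<Sum>b\<in>K d. (norm (?S b))\<^sup>2) = (\<Sum>b\<in>K d. ?S b * cnj (?S b))"
    by (simp only: of_real_sum complex_norm_square)
  also have "\<dots> = (\<Sum>b\<in>K d. \<Sum>y | Tr n d y = b. ?S (Tr n d y) * cnj (h y))"
    by (simp add: trace_char_sum_def sum_distrib_left)
  also have "\<dots> = (\<Sum>y\<in>UNIV. ?S (Tr n d y) * cnj (h y))"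
    by (rule sum_over_traces[OF d])
  also have "\<dots> = (\<Sum>y\<in>UNIV-{0}. ?S (Tr n d y) * cnj (h y))"
    using h by (intro sum.mono_neutral_right) (auto simp: mult_char_def)
  also have "\<dots> = (\<Sum>y\<in>UNIV-{0}. \<Sum>t | Tr n d ((t - 1) * y) = 0. h t)"
  proof (rule sum.cong)
    fix y :: 'a
    assume y: "y \<in> UNIV - {0}"
    \<comment> \<open>Substitution \<open>x = t * y\<close>, possible because
      \<open>y \<noteq> 0\<close>.\<close>
    have "?S (Tr n d y) = (\<Sum>t | Tr n d ((t - 1) * y) = 0. h (t * y))"
      unfolding trace_char_sum_def
      by (rule sum.reindex_bij_witness[of _ "\<lambda>t. t * y" "\<lambda>x. x / y"])
         (use y in \<open>auto simp: Tr_diff algebra_simps\<close>)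
    also have "\<dots> * cnj (h y) = (\<Sum>t | Tr n d ((t - 1) * y) = 0. h t * (h y * cnj (h y)))"
      unfolding sum_distrib_right using h by (intro sum.cong) (auto simp: mult_char_def mult_ac)
    also have "h y * cnj (h y) = 1"
      using y norm_mult_char[OF h, of y] by (simp add: complex_norm_square[symmetric])
    finally show "?S (Tr n d y) * cnj (h y) = (\<Sum>t | Tr n d ((t - 1) * y) = 0. h t)"
      by simp
  qed simp
  also have "\<dots> = (\<Sum>t\<in>UNIV. \<Sum>y | y \<noteq> 0 \<and> Tr n d ((t - 1) * y) = 0. h t)"
    using sum.swap_restrict[of "UNIV - {0 :: 'a}" "UNIV :: 'a set" "\<lambda>y t. h t" "\<lambda>y t. Tr n d ((t - 1) * y) = 0"]
    by simp
  \<comment> \<open>The number of \<open>y\<close> is \<open>c\<close> for all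
    \<open>t \<noteq> 1\<close> and \<open>q ^ n - 1\<close> for \<open>t = 1\<close>; the part with
    constant factor \<open>c\<close> then vanishes by orthogonality.\<close>
  also have "\<dots> = (\<Sum>t\<in>UNIV. c * h t + (if t = 1 then of_nat (q ^ n - 1) - c else 0))"
    by (rule sum.cong) (use h in \<open>auto simp: card_traceless_multiples[OF d] c_def mult_char_def\<close>)
  also have "\<dots> = c * (\<Sum>t\<in>UNIV. h t) + (of_nat (q ^ n - 1) - c)"
    by (simp add: sum.distrib sum_distrib_left)
  also have "\<dots> = complex_of_real (real (q ^ n) - real (q ^ (n - d)))"
    using sum_mult_char[OF h nontriv] ineq by (simp add: c_def of_nat_diff)
  finally show ?thesis
    by (simp only: of_real_eq_iff)
qed

text \<open>By scaling, the \<open>q ^ d - 1\<close> sums over nonzero traces have equal absolute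
  value. The second moment bounds their total, the term of trace 0 being nonnegative.\<close>

lemma trace_char_sum_bound:
  assumes d: "d dvd n" and b: "b \<in> K d" "b \<noteq> 0" and h: "mult_char h" and nontriv: "x \<noteq> 0" "h x \<noteq> 1"
  shows   "(norm (trace_char_sum d h b))\<^sup>2 \<le> q ^ (n - d)"
proof -
  let ?S = "trace_char_sum d h"
  have "d > 0"
    using d dvd_n_pos by blast
  hence qd: "q ^ d > 1"
    by (rule one_less_power[OF q_gt_1])
  have "d \<le> n"
    using d n_pos by (rule dvd_imp_le)
  hence pow: "q ^ n = q ^ d * q ^ (n - d)"
    by (simp flip: power_add)
  have "norm (?S c) = norm (?S b)" if "c \<in> K d - {0}" for c
  proof -
    have "?S (c / b * b) = h (c / b) * ?S b"
      using that b by (intro trace_char_sum_mult[OF h] K_divide) auto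
    thus ?thesis
      using b that norm_mult_char[OF h, of "c / b"] by (simp add: norm_mult)
  qed
  hence "(\<Sum>c\<in>K d - {0}. (norm (?S c))\<^sup>2) = (\<Sum>c\<in>K d - {0}. (norm (?S b))\<^sup>2)"
    by (intro sum.cong) auto
  also have "\<dots> = (real (q ^ d) - 1) * (norm (?S b))\<^sup>2"
    using qd by (simp add: card_Diff_singleton card_K[OF d] of_nat_diff)
  finally have "(real (q ^ d) - 1) * (norm (?S b))\<^sup>2 \<le> (\<Sum>c\<in>K d. (norm (?S c))\<^sup>2)"
    using sum_mono2[of "K d" "K d - {0}" "\<lambda>c. (norm (?S c))\<^sup>2"] by simp
  also have "\<dots> = (real (q ^ d) - 1) * real (q ^ (n - d))"
    by (simp add: trace_char_sum_second_moment[OF d h nontriv] pow algebra_simps)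
  finally show ?thesis
    by (rule mult_left_le_imp_le) (use qd in \<open>simp del: of_nat_power\<close>)
qed

text \<open>If \<open>h\<close> is trivial on \<open>K d\<close>, the sums over nonzero traces are
  equal. By orthogonality each is the sum over trace 0 divided by \<open>-(q ^ d - 1)\<close>. For
  \<open>n = 2 * d\<close> that sum has just \<open>q ^ d - 1\<close> nonzero terms.\<close>

lemma trace_char_sum_quadratic_bound:
  assumes n: "n = 2 * d" and b: "b \<in> K d" "b \<noteq> 0" and h: "mult_char h" and nontriv: "x \<noteq> 0" "h x \<noteq> 1"
    and triv: "\<And>c. c \<in> K d \<Longrightarrow> c \<noteq> 0 \<Longrightarrow> h c = 1"
  shows   "norm (trace_char_sum d h b) \<le> 1"
proof -
  let ?S = "trace_char_sum d h"
  have d: "d dvd n" and "d > 0"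
    using n n_pos by auto
  hence qd: "q ^ d > 1"
    using one_less_power[OF q_gt_1] by blast
  have eq: "?S c = ?S b" if "c \<in> K d - {0}" for c
    using trace_char_sum_mult[OF h, of "c / b" d b] triv[of "c / b"] that b K_divide[of c d b] by simp
  have "0 = (\<Sum>c\<in>K d. ?S c)"
    using sum_mult_char[OF h nontriv] unfolding trace_char_sum_def sum_over_traces[OF d] ..
  also have "\<dots> = ?S 0 + (\<Sum>c\<in>K d - {0}. ?S c)"
    by (rule sum.remove) auto
  also have "(\<Sum>c\<in>K d - {0}. ?S c) = (\<Sum>c\<in>K d - {0}. ?S b)"
    using eq by (intro sum.cong) auto
  finally have "of_nat (q ^ d - 1) * ?S b = - ?S 0"
    by (simp add: card_Diff_singleton card_K[OF d] eq_neg_iff_add_eq_0 add.commute)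
  hence "norm (of_nat (q ^ d - 1) * ?S b) = norm (?S 0)"
    by (metis norm_minus_cancel)
  also have "?S 0 = (\<Sum>y | y \<noteq> 0 \<and> Tr n d (1 * y) = 0. h y)"
    unfolding trace_char_sum_def using h by (intro sum.mono_neutral_right) (auto simp: mult_char_def)
  also have "norm \<dots> \<le> (\<Sum>y | y \<noteq> 0 \<and> Tr n d (1 * y) = 0. 1)"
    by (rule sum_norm_le) (use norm_mult_char[OF h] in auto)
  also have "\<dots> = real (q ^ d - 1)"
    using card_traceless_multiples[OF d, of 1] n by simp
  finally have "real (q ^ d - 1) * norm (?S b) \<le> real (q ^ d - 1) * 1"
    by (simp only: norm_mult norm_of_nat mult_1_right)
  thus ?thesis
    by (rule mult_left_le_imp_le) (use qd in \<open>simp del: of_nat_power\<close>)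
qed

end

section \<open>Sieving for primitive elements\<close>

definition power_residue_weight :: "nat \<Rightarrow> bool \<Rightarrow> real" where
  "power_residue_weight l b = (if b then 1 else - 1 / (real l - 1))"

lemma prod_one_minus:
  fixes f :: "'b \<Rightarrow> real"
  assumes "finite C"
  shows   "(\<Prod>l\<in>C. 1 - f l) = (\<Sum>T\<in>Pow C. (-1) ^ card T * (\<Prod>l\<in>T. f l))"
  using prod_add[OF assms, of "\<lambda>l. - f l" "\<lambda>_. 1"] by (simp add: prod_uminus)

text \<open>
  \<open>D l x\<close> stands for \<open>x\<close> being an \<open>l\<close>-th power. The weight of \<open>l\<close> is the average of the nontrivial
  characters of order \<open>l\<close>. The primes in \<open>C\<close> are sieved exactly by expanding \<open>\<Prod>l\<in>C. 1 - w l x\<close>, which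
  costs a factor \<open>2 ^ card C\<close> in the error term; those in \<open>R\<close> by a union bound.
\<close>
lemma sieve:
  fixes D :: "nat \<Rightarrow> 'b \<Rightarrow> bool" and w :: "nat \<Rightarrow> 'b \<Rightarrow> real"
    and B :: real and B' :: "nat \<Rightarrow> real"
  defines "w \<equiv> \<lambda>l x. power_residue_weight l (D l x)"
  assumes fin: "finite A" "finite C" "finite R" and disj: "C \<inter> R = {}"
    and ge2: "\<And>l. l \<in> C \<union> R \<Longrightarrow> l \<ge> 2"
    and core: "\<And>T. T \<subseteq> C \<Longrightarrow> T \<noteq> {} \<Longrightarrow> \<bar>\<Sum>x\<in>A. \<Prod>l\<in>T. w l x\<bar> \<le> B"
    and rest: "\<And>T l. T \<subseteq> C \<Longrightarrow> l \<in> R \<Longrightarrow> \<bar>\<Sum>x\<in>A. \<Prod>r\<in>insert l T. w r x\<bar> \<le> B' l"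
    and \<delta>: "\<delta> = 1 - (\<Sum>l\<in>R. 1 / real l)" "\<delta> \<ge> 0"
    and main: "2 ^ card C * (\<Sum>l\<in>R. (1 - 1 / real l) * B' l) < \<delta> * (card A - (2 ^ card C - 1) * B)"
  shows "\<exists>x\<in>A. \<forall>l\<in>C \<union> R. \<not> D l x"
proof (rule ccontr)
  assume neg: "\<not> ?thesis"
  \<comment> \<open>\<open>g\<close> vanishes where \<open>D l x\<close> holds for some
    \<open>l \<in> C\<close>; otherwise its factors are \<open>l / (l - 1)\<close>.\<close>
  define g where "g x = (\<Prod>l\<in>C. 1 - w l x)" for x
  have g_nonneg: "g x \<ge> 0" for x
    unfolding g_def by (rule prod_nonneg) (use ge2 in \<open>force simp: w_def power_residue_weight_def field_simps\<close>)
  \<comment> \<open>The indicator of \<open>D l x\<close>, split into the expected density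
    \<open>1 / l\<close> and a fluctuation.\<close>
  have weight: "(if D l x then 1 else 0) = (1 + (real l - 1) * w l x) / real l" if "l \<in> R" for l x
    using ge2[of l] that by (simp add: w_def power_residue_weight_def)
  have sum_g: "(\<Sum>x\<in>A. g x) \<ge> card A - (2 ^ card C - 1) * B"
  proof -
    have "(\<Sum>x\<in>A. g x) = (\<Sum>T\<in>Pow C. \<Sum>x\<in>A. (-1) ^ card T * (\<Prod>l\<in>T. w l x))"
      unfolding g_def by (simp add: prod_one_minus fin sum.swap[of _ A])
    also have "\<dots> = card A + (\<Sum>T\<in>Pow C - {{}}. (-1) ^ card T * (\<Sum>x\<in>A. \<Prod>l\<in>T. w l x))"
      by (subst sum.remove[of _ "{}"]) (use fin in \<open>auto simp: sum_distrib_left\<close>)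
    finally have "(\<Sum>x\<in>A. g x) = card A + (\<Sum>T\<in>Pow C - {{}}. (-1) ^ card T * (\<Sum>x\<in>A. \<Prod>l\<in>T. w l x))" .
    moreover have "\<bar>\<Sum>T\<in>Pow C - {{}}. (-1) ^ card T * (\<Sum>x\<in>A. \<Prod>l\<in>T. w l x)\<bar> \<le> (\<Sum>T\<in>Pow C - {{}}. B)"
      by (rule order.trans[OF sum_abs sum_mono]) (use core in \<open>auto simp: abs_mult power_abs\<close>)
    moreover have "(\<Sum>T\<in>Pow C - {{}}. B) = (2 ^ card C - 1) * B"
      using fin by (simp add: card_Diff_singleton card_Pow of_nat_diff)
    ultimately show ?thesis
      by linarith
  qed
  have sum_gw: "(\<Sum>x\<in>A. g x * w l x) \<le> 2 ^ card C * B' l" if l: "l \<in> R" for l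
  proof -
    have "(\<Sum>x\<in>A. g x * w l x) = (\<Sum>T\<in>Pow C. \<Sum>x\<in>A. (-1) ^ card T * (\<Prod>r\<in>T. w r x) * w l x)"
      unfolding g_def by (simp add: prod_one_minus fin sum_distrib_right sum.swap[of _ A])
    also have "\<dots> = (\<Sum>T\<in>Pow C. (-1) ^ card T * (\<Sum>x\<in>A. \<Prod>r\<in>insert l T. w r x))"
    proof (intro sum.cong refl)
      fix T
      assume "T \<in> Pow C"
      hence "finite T" "l \<notin> T"
        using l disj fin by (auto intro: finite_subset)
      thus "(\<Sum>x\<in>A. (-1) ^ card T * (\<Prod>r\<in>T. w r x) * w l x) = (-1) ^ card T * (\<Sum>x\<in>A. \<Prod>r\<in>insert l T. w r x)"
        by (simp add: sum_distrib_left mult_ac)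
    qed
    also have "\<dots> \<le> (\<Sum>T\<in>Pow C. B' l)"
    proof (rule sum_mono)
      fix T
      assume "T \<in> Pow C"
      hence "\<bar>(-1) ^ card T * (\<Sum>x\<in>A. \<Prod>r\<in>insert l T. w r x)\<bar> \<le> B' l"
        using rest[of T l] l by (simp add: abs_mult power_abs)
      thus "(-1) ^ card T * (\<Sum>x\<in>A. \<Prod>r\<in>insert l T. w r x) \<le> B' l"
        by linarith
    qed
    finally show ?thesis
      by (simp add: card_Pow fin)
  qed
  \<comment> \<open>Union bound: by assumption each \<open>x\<close> is hit by some
    \<open>l\<close>. If \<open>l \<in> C\<close> then \<open>g x = 0\<close>; if
    \<open>l \<in> R\<close> then \<open>g x\<close> occurs on the right.\<close>
  have "(\<Sum>x\<in>A. g x) \<le> (\<Sum>x\<in>A. \<Sum>l\<in>R. g x * (if D l x then 1 else 0))"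
  proof (rule sum_mono)
    fix x
    assume "x \<in> A"
    then obtain l where l: "l \<in> C \<union> R" "D l x"
      using neg by auto
    show "g x \<le> (\<Sum>l\<in>R. g x * (if D l x then 1 else 0))"
    proof (cases "l \<in> C")
      case True
      hence "g x = 0"
        unfolding g_def using fin l by (auto simp: w_def power_residue_weight_def)
      thus ?thesis
        by simp
    next
      case False
      hence "g x * (if D l x then 1 else 0) \<le> (\<Sum>l\<in>R. g x * (if D l x then 1 else 0))"
        by (intro member_le_sum) (use l fin g_nonneg in auto)
      thus ?thesis
        using l by simp
    qed
  qed
  also have "\<dots> = (\<Sum>l\<in>R. \<Sum>x\<in>A. (1 / real l) * g x + (1 - 1 / real l) * (g x * w l x))"
  proof (subst sum.swap, intro sum.cong refl)
    fix l x
    assume "l \<in> R"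
    thus "g x * (if D l x then 1 else 0) = (1 / real l) * g x + (1 - 1 / real l) * (g x * w l x)"
      unfolding weight[OF \<open>l \<in> R\<close>] using ge2[of l] by (simp add: field_simps)
  qed
  also have "\<dots> = (\<Sum>l\<in>R. 1 / real l) * (\<Sum>x\<in>A. g x) + (\<Sum>l\<in>R. (1 - 1 / real l) * (\<Sum>x\<in>A. g x * w l x))"
    by (simp only: sum.distrib sum_distrib_right flip: sum_distrib_left)
  also have "(\<Sum>l\<in>R. (1 - 1 / real l) * (\<Sum>x\<in>A. g x * w l x)) \<le> (\<Sum>l\<in>R. (1 - 1 / real l) * (2 ^ card C * B' l))"
    by (intro sum_mono mult_left_mono) (use ge2 sum_gw in \<open>force simp: field_simps\<close>)+
  also have "\<dots> = 2 ^ card C * (\<Sum>l\<in>R. (1 - 1 / real l) * B' l)"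
    by (simp add: sum_distrib_left mult_ac)
  finally have "\<delta> * (\<Sum>x\<in>A. g x) \<le> 2 ^ card C * (\<Sum>l\<in>R. (1 - 1 / real l) * B' l)"
    by (simp add: \<delta>(1) algebra_simps)
  moreover have "\<delta> * (card A - (2 ^ card C - 1) * B) \<le> \<delta> * (\<Sum>x\<in>A. g x)"
    using sum_g \<delta>(2) by (rule mult_left_mono)
  ultimately show False
    using main by linarith
qed

section \<open>Discrete logarithms and characters of prime order\<close>

context finite_field_tower begin

definition gen :: 'a where
  "gen = (SOME g. g \<noteq> 0 \<and> (\<forall>x. x \<noteq> 0 \<longrightarrow> (\<exists>i. x = g ^ i)))"

text \<open>A discrete logarithm, meaningful only modulo \<open>q ^ n - 1\<close>. For a prime
  \<open>l\<close> dividing \<open>q ^ n - 1\<close>, a nonzero \<open>x\<close> is an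
  \<open>l\<close>-th power iff \<open>l dvd ind x\<close>.\<close>

definition ind :: "'a \<Rightarrow> nat" where
  "ind x = (SOME i. x = gen ^ i)"

lemma gen: "gen \<noteq> 0" "x \<noteq> 0 \<Longrightarrow> \<exists>i. x = gen ^ i"
proof -
  have "\<exists>g::'a. g \<noteq> 0 \<and> (\<forall>x. x \<noteq> 0 \<longrightarrow> (\<exists>i. x = g ^ i))"
    by (rule finite_field_generator) blast
  from someI_ex[OF this] show "gen \<noteq> 0" "x \<noteq> 0 \<Longrightarrow> \<exists>i. x = gen ^ i"
    by (auto simp: gen_def)
qed

lemma gen_power_ind: "x \<noteq> 0 \<Longrightarrow> gen ^ ind x = x"
  using someI_ex[OF gen(2), of x] by (simp add: ind_def)

lemma unit_power_eq_1: "x ^ (q ^ d - 1) = 1" if "x \<in> K d" "x \<noteq> 0"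
proof -
  have "x * x ^ (q ^ d - 1) = x ^ (q ^ d)"
    using q_gt_1 by (cases "q ^ d") auto
  thus ?thesis
    using that by (simp add: K_def)
qed

lemma qn_gt_1: "q ^ n > 1"
  using one_less_power[OF q_gt_1 n_pos] .

lemma gen_power_mod: "gen ^ (i mod (q ^ n - 1)) = gen ^ i"
proof -
  have "gen ^ i = gen ^ ((q ^ n - 1) * (i div (q ^ n - 1)) + i mod (q ^ n - 1))"
    by simp
  also have "\<dots> = gen ^ (i mod (q ^ n - 1))"
    using unit_power_eq_1[of gen n] gen(1) by (simp only: power_add power_mult K_n) simp
  finally show ?thesis ..
qed

text \<open>The powers with exponents below \<open>q ^ n - 1\<close> reach all
  \<open>q ^ n - 1\<close> nonzero elements, so they are distinct.\<close>

lemma gen_power_eq_iff: "gen ^ i = gen ^ j \<longleftrightarrow> [i = j] (mod (q ^ n - 1))"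
proof -
  let ?M = "q ^ n - 1"
  have "UNIV - {0} \<subseteq> (\<lambda>i. gen ^ i) ` {..<?M}"
  proof
    fix x :: 'a
    assume "x \<in> UNIV - {0}"
    hence "x = gen ^ (ind x mod ?M)"
      using gen_power_mod[of "ind x"] gen_power_ind[of x] by simp
    thus "x \<in> (\<lambda>i. gen ^ i) ` {..<?M}"
      using qn_gt_1 by auto
  qed
  moreover have "card (UNIV - {0 :: 'a}) = ?M"
    by (simp add: card card_Diff_singleton)
  ultimately have "?M \<le> card ((\<lambda>i. gen ^ i) ` {..<?M})"
    by (metis card_mono finite)
  hence "inj_on (\<lambda>i. gen ^ i) {..<?M}"
    by (intro eq_card_imp_inj_on) (auto intro: antisym card_image_le[of "{..<?M}", simplified])
  hence "gen ^ (i mod ?M) = gen ^ (j mod ?M) \<longleftrightarrow> i mod ?M = j mod ?M"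
    using qn_gt_1 by (auto dest: inj_onD)
  thus ?thesis
    by (simp only: gen_power_mod cong_def)
qed

lemma ind_gen_power: "[ind (gen ^ i) = i] (mod (q ^ n - 1))"
  unfolding gen_power_eq_iff[symmetric] by (intro gen_power_ind) (use gen(1) in simp)

text \<open>\<open>ind x\<close> is invertible modulo \<open>q ^ n - 1\<close>, so
  \<open>gen\<close> is a power of \<open>x\<close>.\<close>

lemma primitive_elementI:
  assumes "x \<noteq> 0" and "\<And>l. prime l \<Longrightarrow> l dvd q ^ n - 1 \<Longrightarrow> \<not> l dvd ind x"
  shows   "primitive_element x"
proof -
  have "coprime (ind x) (q ^ n - 1)"
  proof (rule ccontr)
    assume "\<not> coprime (ind x) (q ^ n - 1)"
    then obtain l where "prime l" "l dvd gcd (ind x) (q ^ n - 1)"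
      using prime_factor_nat coprime_iff_gcd_eq_1 by blast
    thus False
      using assms(2) by (meson dvd_trans gcd_dvd1 gcd_dvd2)
  qed
  then obtain u where "[ind x * u = 1] (mod (q ^ n - 1))"
    using coprime_iff_invertible_nat by auto
  hence "gen ^ (ind x * u) = gen ^ 1"
    by (simp only: gen_power_eq_iff)
  hence "x ^ u = gen"
    using gen_power_ind[OF assms(1)] by (simp add: power_mult)
  hence "y \<in> range (\<lambda>i :: int. x powi i)" if "y \<noteq> 0" for y
    using gen_power_ind[OF that] by (intro image_eqI[of _ _ "int (u * ind y)"]) (simp_all only: power_int_of_nat power_mult UNIV_I)
  thus ?thesis
    unfolding primitive_element_def using assms(1) by (auto simp: power_int_eq_0_iff)
qed

text \<open>For \<open>l dvd q ^ n - 1\<close> these are the characters of order dividing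
  \<open>l\<close>; \<open>j = 0\<close> gives the trivial one.\<close>

definition residue_char :: "nat \<Rightarrow> nat \<Rightarrow> 'a \<Rightarrow> complex" where
  "residue_char l j x = (if x = 0 then 0 else cis (2 * pi * real j * real (ind x) / real l))"

lemma cis_cong:
  assumes "[a = b] (mod l)" "l > 0"
  shows   "cis (2 * pi * real j * real a / real l) = cis (2 * pi * real j * real b / real l)"
proof -
  have "cis (2 * pi * real j * real a / real l) = cis (2 * pi * real j * real (a mod l) / real l)" for a
  proof -
    have "real a = real l * real (a div l) + real (a mod l)"
      by (simp flip: of_nat_mult of_nat_add)
    hence "2 * pi * real j * real a / real l
        = 2 * pi * real j * real (a mod l) / real l + 2 * pi * real (j * (a div l))"
      using \<open>l > 0\<close> by (simp add: field_simps)
    thus ?thesis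
      by (simp add: cis_mult[symmetric] cis_multiple_2pi)
  qed
  from this[of a] this[of b] show ?thesis
    using assms(1) by (simp add: cong_def)
qed

lemma residue_char_gen:
  assumes "l dvd q ^ n - 1"
  shows   "residue_char l j (gen ^ i) = cis (2 * pi * real j * real i / real l)"
proof -
  have "l > 0"
    using assms qn_gt_1 by (auto intro: Nat.gr0I)
  thus ?thesis
    using cis_cong[OF cong_dvd_modulus_nat[OF ind_gen_power assms], of j] gen(1)
    by (simp add: residue_char_def)
qed

lemma mult_char_residue_char:
  assumes "l dvd q ^ n - 1"
  shows   "mult_char (residue_char l j)"
proof -
  have "residue_char l j (x * y) = residue_char l j x * residue_char l j y" if "x \<noteq> 0" "y \<noteq> 0" for x y
  proof -
    obtain a b where "x = gen ^ a" "y = gen ^ b"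
      using gen(2) \<open>x \<noteq> 0\<close> \<open>y \<noteq> 0\<close> by blast
    thus ?thesis
      by (simp add: residue_char_gen[OF assms] cis_mult algebra_simps add_divide_distrib flip: power_add)
  qed
  moreover have "residue_char l j 1 = 1"
    using residue_char_gen[OF assms, of j 0] by simp
  ultimately show ?thesis
    unfolding mult_char_def by (auto simp: residue_char_def)
qed

lemma cis_eq_1_iff_dvd:
  assumes "prime l"
  shows "cis (2 * pi * real i / real l) = 1 \<longleftrightarrow> l dvd i"
proof
  have "l > 0"
    using assms by (rule prime_gt_0_nat)
  show "l dvd i" if "cis (2 * pi * real i / real l) = 1"
  proof -
    have "cos (2 * pi * real i / real l) = 1"
      using that by (metis cis.sel(1) one_complex.sel(1))
    then obtain k :: int where "2 * pi * real i / real l = of_int k * 2 * pi"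
      by (auto simp: cos_one_2pi_int)
    hence "real i = of_int k * real l"
      using \<open>l > 0\<close> by (simp add: field_simps)
    hence "int i = k * int l"
      by (metis of_int_eq_iff of_int_mult of_int_of_nat_eq)
    thus ?thesis
      by (metis dvd_triv_right int_dvd_int_iff)
  qed
  show "cis (2 * pi * real i / real l) = 1" if "l dvd i"
    using that cis_cong[of i 0 l 1] \<open>l > 0\<close> by (simp add: cong_0_iff)
qed

text \<open>The geometric sum over all \<open>j < l\<close> is \<open>l\<close> or 0. Removing the
  trivial character leaves \<open>l - 1\<close> or \<open>-1\<close>.\<close>

lemma power_residue_weight_eq:
  assumes "prime l" "x \<noteq> 0"
  shows   "complex_of_real (power_residue_weight l (l dvd ind x))
    = (\<Sum>j\<in>{1..<l}. residue_char l j x) / (of_nat l - 1)"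
proof -
  define z where "z = cis (2 * pi * real (ind x) / real l)"
  have "l \<ge> 2"
    using assms(1) by (rule prime_ge_2_nat)
  have pow: "residue_char l j x = z ^ j" for j
    using assms(2) by (simp add: residue_char_def z_def DeMoivre mult_ac)
  have "{..<l} = insert 0 {1..<l}"
    using \<open>l \<ge> 2\<close> by auto
  hence sum: "(\<Sum>j<l. z ^ j) = 1 + (\<Sum>j\<in>{1..<l}. z ^ j)"
    by simp
  have "of_nat l - 1 \<noteq> (0 :: complex)"
    using \<open>l \<ge> 2\<close> by (metis One_nat_def Suc_1 eq_iff_diff_eq_0 not_less_eq_eq of_nat_1_eq_iff order_refl)
  show ?thesis
  proof (cases "l dvd ind x")
    case True
    hence "z = 1"
      using cis_eq_1_iff_dvd[OF assms(1)] by (simp add: z_def)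
    thus ?thesis
      using True \<open>of_nat l - 1 \<noteq> 0\<close> \<open>l \<ge> 2\<close>
      by (simp add: pow power_residue_weight_def of_nat_diff)
  next
    case False
    hence "z \<noteq> 1"
      using cis_eq_1_iff_dvd[OF assms(1)] by (simp add: z_def)
    moreover have "z ^ l = 1"
      using cis_multiple_2pi[of "real (ind x)"] \<open>l \<ge> 2\<close> by (simp add: z_def DeMoivre)
    ultimately have "(\<Sum>j<l. z ^ j) = 0"
      by (simp add: geometric_sum)
    hence "(\<Sum>j\<in>{1..<l}. z ^ j) = -1"
      using sum by (metis add_eq_0_iff)
    thus ?thesis
      using False by (simp add: pow power_residue_weight_def)
  qed
qed

text \<open>Expanding the product of averages gives an average of products of characters, with one
  nontrivial factor for each \<open>l \<in> T\<close>. Such a product is again nontrivial, so every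
  term is bounded by \<open>B\<close>.\<close>

lemma sum_power_residue_weight_bound:
  assumes T: "finite T" "T \<noteq> {}" "\<And>l. l \<in> T \<Longrightarrow> prime l \<and> l dvd q ^ n - 1"
    and A: "0 \<notin> A"
    and bound: "\<And>h y. mult_char h \<Longrightarrow> y \<noteq> 0 \<Longrightarrow> h y \<noteq> 1 \<Longrightarrow> (\<And>x. x \<noteq> 0 \<Longrightarrow> h x ^ \<Prod>T = 1)
      \<Longrightarrow> norm (\<Sum>x\<in>A. h x) \<le> B"
  shows "\<bar>\<Sum>x\<in>A. \<Prod>l\<in>T. power_residue_weight l (l dvd ind x)\<bar> \<le> B"
proof -
  let ?J = "Pi\<^sub>E T (\<lambda>l. {1..<l})"
  define h where "h \<phi> x = (\<Prod>l\<in>T. residue_char l (\<phi> l) x)" for \<phi> x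
  define c where "c = (\<Prod>l\<in>T. real l - 1)"
  have c: "c = card ?J"
    unfolding c_def using T
    by (auto simp: card_PiE of_nat_diff prime_ge_Suc_0_nat intro!: prod.cong)
  have pos: "c > 0"
    unfolding c_def by (rule prod_pos) (use T prime_gt_1_nat in force)
  have norm_h: "norm (\<Sum>x\<in>A. h \<phi> x) \<le> B" if \<phi>: "\<phi> \<in> ?J" for \<phi>
  proof -
    obtain l where l: "l \<in> T"
      using T(2) by auto
    have h: "mult_char (h \<phi>)"
      using mult_char_residue_char T l by (fastforce simp: mult_char_def h_def prod.distrib)
    have "\<phi> l \<in> {1..<l}"
      using \<phi> l by auto
    hence "\<not> l dvd \<phi> l"
      by (auto dest: dvd_imp_le)
    moreover have "\<not> l dvd \<Prod>(T - {l})"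
    proof
      assume "l dvd \<Prod>(T - {l})"
      then obtain r where "r \<in> T - {l}" "l dvd r"
        using T l by (auto simp: prime_dvd_prod_iff)
      thus False
        using T(3)[of l] T(3)[of r] l primes_dvd_imp_eq by blast
    qed
    ultimately have nd: "\<not> l dvd \<phi> l * \<Prod>(T - {l})"
      using T l by (simp add: prime_dvd_mult_iff)
    have pow: "residue_char r j (gen ^ s) = 1" if "r \<in> T" "r dvd s" for r j s
    proof -
      have "r dvd j * s"
        using that by simp
      thus ?thesis
        using T that residue_char_gen[of r j s] cis_eq_1_iff_dvd[of r "j * s"] by (simp add: mult_ac)
    qed
    \<comment> \<open>This power of \<open>gen\<close> makes all factors trivial except the one for
      \<open>l\<close>.\<close>
    have "h \<phi> (gen ^ \<Prod>(T - {l})) = residue_char l (\<phi> l) (gen ^ \<Prod>(T - {l})) * (\<Prod>r\<in>T - {l}. 1)"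
      unfolding h_def prod.remove[OF T(1) l]
      by (intro arg_cong2[of _ _ _ _ "(*)"] prod.cong pow dvd_prodI) (use T in auto)
    also have "\<dots> \<noteq> 1"
      using T l nd residue_char_gen[of l "\<phi> l" "\<Prod>(T - {l})"] cis_eq_1_iff_dvd[of l "\<phi> l * \<Prod>(T - {l})"]
      by (simp add: mult_ac)
    finally have "h \<phi> (gen ^ \<Prod>(T - {l})) \<noteq> 1" .
    moreover have "h \<phi> x ^ \<Prod>T = 1" if "x \<noteq> 0" for x
    proof -
      have "h \<phi> x ^ \<Prod>T = h \<phi> (x ^ \<Prod>T)"
        using h by (simp add: mult_char_power)
      also have "x ^ \<Prod>T = gen ^ (ind x * \<Prod>T)"
        using gen_power_ind[OF that] by (simp add: power_mult)
      also have "h \<phi> \<dots> = 1"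
        unfolding h_def by (intro prod.neutral ballI pow dvd_mult dvd_prodI) (use T in auto)
      finally show ?thesis .
    qed
    ultimately show ?thesis
      using gen(1) by (intro bound[OF h, of "gen ^ \<Prod>(T - {l})"]) auto
  qed
  have "complex_of_real (\<Sum>x\<in>A. \<Prod>l\<in>T. power_residue_weight l (l dvd ind x))
      = (\<Sum>x\<in>A. \<Prod>l\<in>T. (\<Sum>j\<in>{1..<l}. residue_char l j x) / (of_nat l - 1))"
    unfolding of_real_sum of_real_prod
    by (intro sum.cong prod.cong refl power_residue_weight_eq) (use T A in auto)
  also have "\<dots> = (\<Sum>x\<in>A. (\<Sum>\<phi>\<in>?J. h \<phi> x) / of_real c)"
    using T(1) by (simp add: prod_dividef prod_sum_PiE h_def c_def)
  also have "\<dots> = (\<Sum>\<phi>\<in>?J. \<Sum>x\<in>A. h \<phi> x) / of_real c"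
    by (simp only: sum_divide_distrib[symmetric] sum.swap[of _ A])
  finally have "\<bar>\<Sum>x\<in>A. \<Prod>l\<in>T. power_residue_weight l (l dvd ind x)\<bar>
      = norm ((\<Sum>\<phi>\<in>?J. \<Sum>x\<in>A. h \<phi> x) / of_real c)"
    by (metis norm_of_real real_norm_def)
  also have "\<dots> \<le> (\<Sum>\<phi>\<in>?J. B) / c"
    using pos sum_norm_le[of ?J "\<lambda>\<phi>. \<Sum>x\<in>A. h \<phi> x" "\<lambda>_. B", OF norm_h]
    by (simp add: norm_divide divide_right_mono)
  also have "\<dots> = B"
    using pos by (simp add: c)
  finally show ?thesis .
qed

end

section \<open>Estimates for the sieve\<close>

text \<open>Compares a set of primes with an initial segment of them. Dividing each prime by a
  threshold first allows for different cardinalities.\<close>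

lemma prod_le_prod_exchange:
  fixes f :: "'b \<Rightarrow> real"
  assumes "finite U" "finite R" and pos: "\<And>x. f x \<ge> 0"
    and U: "\<And>x. x \<in> U - R \<Longrightarrow> f x \<le> 1" and R: "\<And>x. x \<in> R - U \<Longrightarrow> f x \<ge> 1"
  shows "prod f U \<le> prod f R"
proof -
  have "prod f U = prod f (U \<inter> R) * prod f (U - R)"
    using prod.Int_Diff[OF assms(1), of f R] .
  also have "\<dots> \<le> prod f (U \<inter> R) * 1"
    by (intro mult_left_mono prod_le_1 prod_nonneg) (use pos U in auto)
  also have "\<dots> \<le> prod f (U \<inter> R) * prod f (R - U)"
    by (intro mult_left_mono prod_ge_1 prod_nonneg) (use pos R in auto)
  also have "\<dots> = prod f R"
    using prod.Int_Diff[OF assms(2), of f U] by (simp add: Int_commute)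
  finally show ?thesis .
qed

lemma sum_le_sum_exchange:
  fixes f :: "'b \<Rightarrow> real"
  assumes "finite U" "finite R"
    and U: "\<And>x. x \<in> U - R \<Longrightarrow> f x \<ge> 0" and R: "\<And>x. x \<in> R - U \<Longrightarrow> f x \<le> 0"
  shows "sum f R \<le> sum f U"
proof -
  have "sum f R = sum f (U \<inter> R) + sum f (R - U)"
    using sum.Int_Diff[OF assms(2), of f U] by (simp add: Int_commute)
  also have "\<dots> \<le> sum f (U \<inter> R) + sum f (U - R)"
    using sum_nonneg[of "U - R" f, OF U] sum_nonpos[of "R - U" f, OF R] by simp
  also have "\<dots> = sum f U"
    using sum.Int_Diff[OF assms(1), of f R] by simp
  finally show ?thesis .
qed

lemma prime_le_60:
  assumes "prime p" "p \<le> 60"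
  shows   "p \<in> {2, 3, 5, 7, 11, 13, 17, 19, 23, 29, 31, 37, 41, 43, 47, 53, 59 :: nat}"
proof -
  have "p \<in> set [2..<61]"
    using assms prime_ge_2_nat[of p] by (simp del: upt_rec_numeral)
  thus ?thesis
    using assms(1) by (auto simp: upt_rec_numeral simp del: set_upt)
qed

text \<open>The number \<open>200560490130\<close> is the product of the primes up to 31.\<close>
lemma prod_ge_primorial:
  assumes P: "finite P" "\<And>p. p \<in> P \<Longrightarrow> prime p"
  shows   "32 ^ card P * 200560490130 \<le> (32 ^ 11 * real (\<Prod>P))"
proof -
  let ?U = "{2, 3, 5, 7, 11, 13, 17, 19, 23, 29, 31 :: nat}"
  \<comment> \<open>The threshold 32 separates the consecutive primes 31 and 37. Being
    \<open>2 ^ 5\<close>, it also fits the fifth power of \<open>2 ^ card P\<close>.\<close>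
  have "(\<Prod>p\<in>?U. real p / 32) \<le> (\<Prod>p\<in>P. real p / 32)"
  proof (rule prod_le_prod_exchange)
    show "1 \<le> real p / 32" if "p \<in> P - ?U" for p
      using that prime_le_60[of p] P by force
  qed (use P in auto)
  also have "\<dots> = real (\<Prod>P) / 32 ^ card P"
    by (simp add: prod_dividef)
  finally show ?thesis
    by (simp add: field_simps)
qed

text \<open>The number \<open>180000 ^ 4\<close> is less than the product of the fifteen primes from 7 to 61.\<close>
lemma large_prime_set_bounds:
  assumes R: "finite R" "\<And>p. p \<in> R \<Longrightarrow> prime p \<and> p \<ge> 7" and prod: "real (\<Prod>R) \<le> 180000 ^ 4"
  shows   "card R \<le> 14" and "(\<Sum>p\<in>R. 1 / real p) \<le> 0.665"
proof -
  let ?U = "{7, 11, 13, 17, 19, 23, 29, 31, 37, 41, 43, 47, 53, 59 :: nat}"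
  have RU: "p > 60" if "p \<in> R - ?U" for p
    using that prime_le_60[of p] R(2)[of p] by force
  have "(\<Prod>p\<in>?U. real p / 59) \<le> (\<Prod>p\<in>R. real p / 59)"
  proof (rule prod_le_prod_exchange)
    show "real x / 59 \<le> 1" if "x \<in> ?U - R" for x
      using that by auto
    show "1 \<le> real x / 59" if "x \<in> R - ?U" for x
      using RU[OF that] by simp
  qed (use R(1) in auto)
  also have "\<dots> = real (\<Prod>R) / 59 ^ card R"
    by (simp add: prod_dividef)
  finally have *: "59 ^ card R * (\<Prod>p\<in>?U. real p / 59) \<le> 180000 ^ 4"
    using prod by (simp add: field_simps)
  show "card R \<le> 14"
  proof (rule ccontr)
    assume "\<not> card R \<le> 14"
    hence "(59 :: real) ^ 15 \<le> 59 ^ card R"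
      by (intro power_increasing) auto
    \<comment> \<open>The left-hand side is 59 times the product of \<open>?U\<close>, which exceeds
      \<open>180000 ^ 4\<close>.\<close>
    hence "59 ^ 15 * (\<Prod>p\<in>?U. real p / 59) \<le> 59 ^ card R * (\<Prod>p\<in>?U. real p / 59)"
      by (intro mult_right_mono prod_nonneg) auto
    from order.trans[OF this *] show False
      by simp
  qed
  \<comment> \<open>After subtracting \<open>1 / 59\<close>, primes above 59 contribute nonpositive
    terms; the subtracted amount is at most \<open>14 / 59\<close>.\<close>
  have "(\<Sum>p\<in>R. 1 / real p - 1 / 59) \<le> (\<Sum>p\<in>?U. 1 / real p - 1 / 59)"
  proof (rule sum_le_sum_exchange)
    show "0 \<le> 1 / real x - 1 / 59" if "x \<in> ?U - R" for x
      using that by auto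
    show "1 / real x - 1 / 59 \<le> 0" if "x \<in> R - ?U" for x
      using RU[OF that] by (simp add: field_simps)
  qed (use R(1) in auto)
  hence "(\<Sum>p\<in>R. 1 / real p) \<le> real (card R) / 59 + (\<Sum>p\<in>?U. 1 / real p - 1 / 59)"
    by (simp add: sum_subtractf)
  also have "\<dots> \<le> 14 / 59 + (\<Sum>p\<in>?U. 1 / real p - 1 / 59)"
    using \<open>card R \<le> 14\<close> by simp
  also have "\<dots> \<le> 0.665"
    by simp
  finally show "(\<Sum>p\<in>R. 1 / real p) \<le> 0.665" .
qed

section \<open>The sieve on the fibres of the trace\<close>

context finite_field_tower begin

lemma trace_weight_sum_bound:
  assumes d: "d dvd n" and b: "b \<in> K d" "b \<noteq> 0" and T: "T \<subseteq> prime_factors (q ^ n - 1)" "T \<noteq> {}"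
  shows   "\<bar>\<Sum>x | Tr n d x = b. \<Prod>l\<in>T. power_residue_weight l (l dvd ind x)\<bar> \<le> sqrt (q ^ (n - d))"
proof (rule sum_power_residue_weight_bound)
  show "prime l \<and> l dvd q ^ n - 1" if "l \<in> T" for l
    using that T(1) by auto
  show "norm (\<Sum>x | Tr n d x = b. h x) \<le> sqrt (q ^ (n - d))"
    if "mult_char h" "y \<noteq> 0" "h y \<noteq> 1" for h y
    using trace_char_sum_bound[OF d b that] unfolding trace_char_sum_def by (intro real_le_rsqrt)
qed (use b T finite_subset[OF T(1)] in auto)

text \<open>On nonzero elements of \<open>K d\<close> the discrete logarithm is divisible by
  \<open>q ^ d + 1\<close>. They are therefore \<open>l\<close>-th powers, and characters of
  exponent \<open>l\<close> are trivial on them.\<close>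

lemma trace_weight_sum_quadratic_bound:
  assumes n: "n = 2 * d" and b: "b \<in> K d" "b \<noteq> 0" and l: "prime l" "l dvd q ^ d + 1"
  shows   "\<bar>\<Sum>x | Tr n d x = b. \<Prod>r\<in>{l}. power_residue_weight r (r dvd ind x)\<bar> \<le> 1"
proof (rule sum_power_residue_weight_bound)
  have d: "d > 0"
    using n n_pos by simp
  have qd: "q ^ d > 1"
    using one_less_power[OF q_gt_1 d] .
  have "q ^ n = q ^ d * q ^ d"
    unfolding n mult_2 power_add ..
  hence M: "q ^ n - 1 = (q ^ d - 1) * (q ^ d + 1)"
    by (simp add: algebra_simps)
  show "prime r \<and> r dvd q ^ n - 1" if "r \<in> {l}" for r
    using that l unfolding M by (auto simp del: mult_Suc_right add_Suc_right)
  fix h :: "'a \<Rightarrow> complex" and y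
  assume h: "mult_char h" "y \<noteq> 0" "h y \<noteq> 1" "\<And>x. x \<noteq> 0 \<Longrightarrow> h x ^ \<Prod>{l} = 1"
  have "h c = 1" if c: "c \<in> K d" "c \<noteq> 0" for c
  proof -
    have "gen ^ (ind c * (q ^ d - 1)) = gen ^ 0"
      using unit_power_eq_1[OF c] gen_power_ind[OF c(2)] by (simp add: power_mult)
    hence "(q ^ d - 1) * (q ^ d + 1) dvd (q ^ d - 1) * ind c"
      unfolding gen_power_eq_iff M cong_0_iff by (simp only: mult.commute)
    hence "q ^ d + 1 dvd ind c"
      by (subst (asm) nat_mult_dvd_cancel1) (use qd in simp_all)
    then obtain j where "ind c = l * j"
      using l(2) by (meson dvd_trans dvdE)
    hence "c = (gen ^ j) ^ l"
      using gen_power_ind[OF c(2)] by (simp add: mult.commute flip: power_mult)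
    thus ?thesis
      using h(4)[of "gen ^ j"] gen(1) by (simp add: mult_char_power[OF h(1)])
  qed
  thus "norm (\<Sum>x | Tr n d x = b. h x) \<le> 1"
    using trace_char_sum_quadratic_bound[OF n b h(1-3)] by (simp add: trace_char_sum_def)
qed (use b in auto)

lemma card_trace_fibre: "d dvd n \<Longrightarrow> b \<in> K d \<Longrightarrow> card {x. Tr n d x = b} = q ^ (n - d)"
  using Tr_image_fibre(1)[OF dvd_refl, of d b] by (simp add: K_n)

text \<open>All errors are \<open>E\<close> and the fibre has \<open>E * E\<close> elements, so
  \<open>main\<close> is the sieve condition divided by \<open>E\<close>. The sum of
  \<open>1 - 1 / l\<close> over \<open>R\<close> is \<open>card R - 1 + \<delta>\<close>.\<close>

lemma exists_primitive_trace_sieve: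
  fixes E \<delta> :: real
  assumes d: "d dvd n" and b: "b \<in> K d" "b \<noteq> 0"
    and CR: "prime_factors (q ^ n - 1) = C \<union> R" "C \<inter> R = {}"
    and E: "E = sqrt (q ^ (n - d))" and \<delta>: "\<delta> = 1 - (\<Sum>l\<in>R. 1 / real l)" "\<delta> \<ge> 0"
    and main: "2 ^ card C * (real (card R) - 1 + \<delta>) < \<delta> * (E - (2 ^ card C - 1))"
  shows "\<exists>x. primitive_element x \<and> Tr n d x = b"
proof -
  have "E > 0"
    using q_gt_1 by (simp add: E)
  have fin: "finite C" "finite R"
    using CR(1) by (metis finite_Un finite_set_mset)+
  have "\<exists>x\<in>{x. Tr n d x = b}. \<forall>l\<in>C \<union> R. \<not> l dvd ind x"
  proof (rule sieve[where B = E and B' = "\<lambda>_. E" and \<delta> = \<delta>])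
    show "2 \<le> l" if "l \<in> C \<union> R" for l
      using that CR(1) by (metis in_prime_factors_imp_prime prime_ge_2_nat)
    show "\<bar>\<Sum>x | Tr n d x = b. \<Prod>l\<in>T. power_residue_weight l (l dvd ind x)\<bar> \<le> E"
      if "T \<subseteq> C" "T \<noteq> {}" for T
      unfolding E using that CR by (intro trace_weight_sum_bound[OF d b]) auto
    show "\<bar>\<Sum>x | Tr n d x = b. \<Prod>r\<in>insert l T. power_residue_weight r (r dvd ind x)\<bar> \<le> E"
      if "T \<subseteq> C" "l \<in> R" for T l
      unfolding E using that CR by (intro trace_weight_sum_bound[OF d b]) auto
    have lhs: "(\<Sum>l\<in>R. (1 - 1 / real l) * E) = (real (card R) - 1 + \<delta>) * E"
      unfolding \<delta>(1) by (simp add: sum_subtractf flip: sum_distrib_right)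
    have ineq: "2 ^ card C * (real (card R) - 1 + \<delta>) * E < \<delta> * (E - (2 ^ card C - 1)) * E"
      using main \<open>E > 0\<close> by (rule mult_strict_right_mono)
    have card: "real (card {x. Tr n d x = b}) = E * E"
      using card_trace_fibre[OF d b(1)] by (simp add: E)
    show "2 ^ card C * (\<Sum>l\<in>R. (1 - 1 / real l) * E)
        < \<delta> * (real (card {x. Tr n d x = b}) - (2 ^ card C - 1) * E)"
      unfolding lhs card using ineq by (simp add: algebra_simps)
  qed (use fin CR \<delta> in auto)
  then obtain x where x: "Tr n d x = b" "\<And>l. l \<in> prime_factors (q ^ n - 1) \<Longrightarrow> \<not> l dvd ind x"
    using CR by auto
  have "primitive_element x"
  proof (rule primitive_elementI)
    show "x \<noteq> 0"
      using x b by auto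
    show "\<not> l dvd ind x" if "prime l" "l dvd q ^ n - 1" for l
      using x(2) that qn_gt_1 by (simp add: prime_factors_dvd)
  qed
  thus ?thesis
    using x by blast
qed

lemma exists_primitive_trace_direct:
  assumes d: "d dvd n" and b: "b \<in> K d" "b \<noteq> 0"
    and main: "2 ^ card (prime_factors (q ^ n - 1)) - 1 < sqrt (q ^ (n - d))"
  shows "\<exists>x. primitive_element x \<and> Tr n d x = b"
  using main by (intro exists_primitive_trace_sieve[OF d b, of _ "{}" _ 1]) auto

text \<open>For \<open>E \<ge> 180000\<close> the number of primes is small enough to sieve all of
  them exactly. Below that, 2, 3 and 5 are sieved exactly and at most 14 further primes by the union
  bound.\<close>

lemma exists_primitive_trace_large:
  assumes d: "d dvd n" "2 * d \<le> n" and b: "b \<in> K d" "b \<noteq> 0" and large: "330 ^ 2 \<le> q ^ (n - d)"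
  shows "\<exists>x. primitive_element x \<and> Tr n d x = b"
proof -
  define E where "E = sqrt (q ^ (n - d))"
  define P where "P = prime_factors (q ^ n - 1)"
  have E330: "E \<ge> 330"
    unfolding E_def by (rule real_le_rsqrt) (use large in \<open>simp flip: of_nat_power\<close>)
  have P: "finite P" "\<And>p. p \<in> P \<Longrightarrow> prime p"
    by (auto simp: P_def)
  have "\<Prod>P dvd (\<Prod>p\<in>P. p ^ multiplicity p (q ^ n - 1))"
    by (rule prod_dvd_prod) (use qn_gt_1 in \<open>auto simp: P_def prime_factors_multiplicity intro!: dvd_power\<close>)
  also have "\<dots> = q ^ n - 1"
    unfolding P_def using qn_gt_1 by (simp add: prod_prime_factors)
  finally have "\<Prod>P dvd q ^ n - 1" .
  hence "\<Prod>P \<le> q ^ n - 1"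
    using qn_gt_1 by (intro dvd_imp_le) auto
  also have "\<dots> < q ^ n"
    using qn_gt_1 by simp
  \<comment> \<open>\<open>2 * d \<le> n\<close> gives \<open>n \<le> 2 * (n - d)\<close>, whence
    the exponent 4 of \<open>E\<close>.\<close>
  also have "\<dots> \<le> q ^ (2 * (n - d))"
    using q_gt_1 d by (intro power_increasing) auto
  finally have "real (\<Prod>P) < real (q ^ (2 * (n - d)))"
    by (simp only: of_nat_less_iff)
  also have "real (q ^ (2 * (n - d))) = E ^ 4"
    unfolding E_def by (simp add: mult.commute[of 2] power_mult power4_eq_xxxx power2_eq_square)
  finally have prodP: "real (\<Prod>P) < E ^ 4" .
  show ?thesis
  proof (cases "E \<ge> 180000") \<comment> \<open>\<open>32 ^ 11 / 200560490130 < 180000\<close>\<close>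
    case True
    have "2 ^ card P \<le> E"
    proof (rule ccontr)
      assume "\<not> 2 ^ card P \<le> E"
      hence "E ^ 5 \<le> (2 ^ card P) ^ 5"
        using E330 by (intro power_mono) auto
      also have "(2 ^ card P) ^ 5 = (32 :: real) ^ card P"
        by (simp flip: power_mult add: mult.commute[of _ 5]) (simp add: power_mult)
      finally have "E ^ 5 * 200560490130 \<le> 32 ^ 11 * real (\<Prod>P)"
        using prod_ge_primorial[OF P] by linarith
      also have "\<dots> < 32 ^ 11 * E ^ 4"
        using prodP by simp
      finally have "E ^ 4 * (E * 200560490130) < E ^ 4 * 32 ^ 11"
        by (simp add: eval_nat_numeral mult_ac)
      hence "E * 200560490130 < 32 ^ 11"
        by (rule mult_left_less_imp_less) (use E330 in auto)
      thus False
        using True by simp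
    qed
    thus ?thesis
      by (intro exists_primitive_trace_direct[OF d(1) b]) (simp add: P_def E_def)
  next
    case False
    define C where "C = P \<inter> {2, 3, 5}"
    define R where "R = P - {2, 3, 5}"
    have CR: "P = C \<union> R" "C \<inter> R = {}" "finite R"
      using P by (auto simp: C_def R_def)
    have R7: "p \<ge> 7" if "p \<in> R" for p
      using that P prime_le_60[of p] by (force simp: R_def)
    have "\<Prod>R \<le> \<Prod>P"
      using P R7 by (intro dvd_imp_le prod_dvd_prod_subset prod_pos)
        (auto simp: R_def prime_gt_0_nat)
    hence "real (\<Prod>R) \<le> E ^ 4"
      using prodP by linarith
    also have "\<dots> \<le> 180000 ^ 4"
      using False E330 by (intro power_mono) auto
    finally have "card R \<le> 14" and R_sum: "(\<Sum>p\<in>R. 1 / real p) \<le> 0.665"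
      using large_prime_set_bounds[of R] CR(3) P(2) R7 by (auto simp: R_def)
    define \<sigma> where "\<sigma> = (\<Sum>p\<in>R. 1 / real p)"
    have \<sigma>: "0 \<le> \<sigma>" "\<sigma> \<le> 0.665"
      using R_sum by (auto simp: \<sigma>_def intro: sum_nonneg)
    have "card C \<le> card {2, 3, 5 :: nat}"
      unfolding C_def by (intro card_mono) auto
    hence "card C \<le> 3"
      by simp
    hence C8: "(2 :: real) ^ card C \<le> 2 ^ 3"
      by (intro power_increasing) auto
    \<comment> \<open>This is the left-hand side of the sieve condition after adding
      \<open>(1 - \<sigma>) * 2 ^ card C\<close> to both sides; the right-hand side becomes
      \<open>(1 - \<sigma>) * (E + 1)\<close>.\<close>
    have "(2 :: real) ^ card C * (real (card R) - \<sigma> + (1 - \<sigma>)) \<le> 2 ^ card C * (14 - \<sigma> + (1 - \<sigma>))"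
      using \<open>card R \<le> 14\<close> by (intro mult_left_mono) auto
    also have "\<dots> \<le> 2 ^ 3 * (14 - \<sigma> + (1 - \<sigma>))"
      using C8 \<sigma> by (intro mult_right_mono) auto
    \<comment> \<open>Tightest at \<open>\<sigma> = 0.665\<close>, with about 109.4 against 110.9;
      the threshold 330 ensures this.\<close>
    also have "\<dots> < (1 - \<sigma>) * 331"
      using \<sigma> by (simp add: algebra_simps)
    also have "\<dots> \<le> (1 - \<sigma>) * (E + 1)"
      using \<sigma> E330 by (intro mult_left_mono) auto
    finally have "2 ^ card C * (real (card R) - 1 + (1 - \<sigma>)) < (1 - \<sigma>) * (E - (2 ^ card C - 1))"
      by (simp add: algebra_simps)
    thus ?thesis
      using CR \<sigma> by (intro exists_primitive_trace_sieve[OF d(1) b, of C R E "1 - \<sigma>"])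
        (auto simp: P_def \<sigma>_def E_def)
  qed
qed

end

section \<open>Small fields and the main theorem\<close>

text \<open>Peels one prime power at a time off an explicit nested factorisation.\<close>

lemma prime_factors_mult_prime_power:
  assumes "prime_factors m = A" "prime p" "k > 0" "m > 0"
  shows   "prime_factors (p ^ k * m :: nat) = insert p A"
proof -
  have "prime_factors (p ^ k * m) = prime_factors (p ^ k) \<union> prime_factors m"
    using assms by (intro prime_factors_product) auto
  also have "prime_factors (p ^ k) = {p}"
    using assms by (simp add: prime_factorization_prime_power)
  finally show ?thesis
    using assms(1) by simp
qed

text \<open>Trial division stops before 35 because \<open>35 * 35 > 1181\<close>. This prime divides
  \<open>3 ^ 20 - 1\<close>.\<close>

lemma prime_1181: "prime (1181 :: nat)"
proof -
  have small: "m = 1" if "m dvd 1181" "m < 35" for m :: nat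
  proof -
    have "m \<noteq> 0"
      using that(1) by (intro notI) simp
    hence "m = 1 \<or> m \<in> set [2..<35]"
      using that(2) by (auto simp del: upt_rec_numeral)
    thus ?thesis
      using that(1) by (auto simp: upt_rec_numeral simp del: set_upt)
  qed
  have "m = 1 \<or> m = 1181" if m: "m dvd 1181" for m :: nat
  proof -
    obtain k where k: "1181 = m * k"
      using m by (elim dvdE)
    have "m < 35 \<or> k < 35"
      using mult_le_mono[of 35 m 35 k] k by linarith
    thus ?thesis
      using small[of m] small[of k] k by (metis dvd_triv_left dvd_triv_right nat_mult_1_right)
  qed
  thus ?thesis
    unfolding prime_nat_iff by simp
qed

text \<open>The divisors of a prime power form a chain.\<close>

lemma incomparable_divisors_imp_not_primepow:
  assumes "a dvd d" "b dvd d" "\<not> a dvd b" "\<not> b dvd (a :: nat)"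
  shows   "\<not> primepow d"
proof
  assume "primepow d"
  then obtain p k where p: "prime p" "d = p ^ k"
    by (auto simp: primepow_def)
  then obtain i j where "a = p ^ i" "b = p ^ j"
    using assms by (metis divides_primepow_nat)
  thus False
    using assms(3,4) le_imp_power_dvd nat_le_linear by blast
qed

lemma not_primepow_6: "\<not> primepow (6 :: nat)"
  by (rule incomparable_divisors_imp_not_primepow[of 2 _ 3]) simp_all

lemma small_not_primepow:
  assumes "d > 1" "\<not> primepow d" "d \<le> 16"
  shows   "d \<in> {6, 10, 12, 14, 15 :: nat}"
proof -
  have pp: "primepow (p ^ k)" if "prime p" "k > 0" for p k :: nat
    using that by (simp add: primepow_prime_power)
  have "primepow (2 :: nat)" "primepow (3 :: nat)" "primepow (4 :: nat)" "primepow (5 :: nat)"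
    "primepow (7 :: nat)" "primepow (8 :: nat)" "primepow (9 :: nat)" "primepow (11 :: nat)"
    "primepow (13 :: nat)" "primepow (16 :: nat)"
    using pp[of 2 1] pp[of 3 1] pp[of 2 2] pp[of 5 1] pp[of 7 1] pp[of 2 3] pp[of 3 2] pp[of 11 1]
      pp[of 13 1] pp[of 2 4] by simp_all
  moreover have "d \<in> set [2..<17]"
    using assms by (simp del: upt_rec_numeral)
  ultimately show ?thesis
    using assms(2) by (auto simp: upt_rec_numeral simp del: set_upt)
qed

lemma power_less_imp_exponent_less:
  assumes "q > (1 :: nat)" "q ^ k < 2 ^ j"
  shows   "k < j"
proof (rule ccontr)
  assume "\<not> k < j"
  hence "2 ^ j \<le> (2 :: nat) ^ k"
    by (intro power_increasing) auto
  also have "\<dots> \<le> q ^ k"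
    using assms by (intro power_mono) auto
  finally show False
    using assms by simp
qed

text \<open>Here \<open>e = n - d\<close>, and \<open>330\<close> is where the general sieve estimate starts to work.\<close>
lemma small_cases:
  assumes q: "primepow q" and d: "d > 1" "\<not> primepow d" "d dvd e" "e > 0" and small: "q ^ e < 330 ^ 2"
  shows   "(q, d, e) \<in> {(2, 6, 6), (3, 6, 6), (4, 6, 6), (5, 6, 6), (2, 10, 10), (3, 10, 10),
     (2, 12, 12), (2, 14, 14), (2, 15, 15), (2 :: nat, 6 :: nat, 12 :: nat)}"
proof -
  have q1: "q > 1"
    using primepow_gt_Suc_0[OF q] by simp
  have "330 ^ 2 < (2 :: nat) ^ 17"
    by simp
  hence "e < 17"
    using power_less_imp_exponent_less[OF q1, of e 17] small by linarith
  hence "d \<le> 16"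
    using d by (auto dest: dvd_imp_le)
  hence d_cases: "d \<in> {6, 10, 12, 14, 15}"
    using small_not_primepow d by blast
  obtain c where c: "e = d * c"
    using d by auto
  have de: "(d, e) \<in> {(6, 6), (6, 12), (10, 10), (12, 12), (14, 14), (15, 15)}"
  proof -
    have "c > 0" "c < 3"
      using c \<open>e < 17\<close> d d_cases by auto
    hence "c \<in> {1, 2}"
      by auto
    thus ?thesis
      using c \<open>e < 17\<close> d_cases by auto
  qed
  have qle: "q < b" if "330 ^ 2 \<le> b ^ e" for b
  proof (rule ccontr)
    assume "\<not> q < b"
    hence "b ^ e \<le> q ^ e"
      by (intro power_mono) auto
    thus False
      using small that by linarith
  qed
  \<comment> \<open>For \<open>e = 6\<close> the size bound allows \<open>q < 7\<close>, and 6 is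
    the only number from 2 to 6 that is not a prime power.\<close>
  have "q \<noteq> 6"
    using q not_primepow_6 by blast
  have "q \<in> {2, 3, 4, 5}" if "e = 6"
  proof -
    have "q < 7"
      by (rule qle) (simp add: that)
    thus ?thesis
      using q1 \<open>q \<noteq> 6\<close> by auto
  qed
  moreover have "q \<in> {2, 3}" if "e = 10"
  proof -
    have "q < 4"
      by (rule qle) (simp add: that)
    thus ?thesis
      using q1 by auto
  qed
  moreover have "q = 2" if "e = 12 \<or> e = 14 \<or> e = 15"
  proof -
    have "q < 3"
      by (rule qle) (use that in auto)
    thus ?thesis
      using q1 by auto
  qed
  ultimately show ?thesis
    using de by (elim insertE; elim Pair_inject emptyE; simp)
qed

context finite_field_tower begin

lemma exists_primitive_trace_few_primes:
  assumes d: "d dvd n" and b: "b \<in> K d" "b \<noteq> 0"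
    and P: "prime_factors (q ^ n - 1) = S" and k: "card S = k" and main: "(2 ^ k - 1) ^ 2 < q ^ (n - d)"
  shows "\<exists>x. primitive_element x \<and> Tr n d x = b"
proof (rule exists_primitive_trace_direct[OF d b])
  have "(2 :: real) ^ card (prime_factors (q ^ n - 1)) - 1 = real (2 ^ k - 1)"
    unfolding P k by (simp add: of_nat_diff)
  also have "\<dots> < sqrt (q ^ (n - d))"
    using main by (intro real_less_rsqrt) (simp only: of_nat_less_iff flip: of_nat_power)
  finally show "2 ^ card (prime_factors (q ^ n - 1)) - 1 < sqrt (q ^ (n - d))" .
qed

text \<open>Five primes are too many for the direct criterion, as \<open>2 ^ 5 - 1 > 27\<close>. So
  only 2 is sieved exactly, and \<open>\<delta>\<close> is
  \<open>1 - 1/5 - 1/7 - 1/13 - 1/73\<close>.\<close>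

lemma exists_primitive_trace_729:
  assumes "q = 3" "n = 12" and b: "b \<in> K 6" "b \<noteq> 0"
  shows "\<exists>x. primitive_element x \<and> Tr n 6 x = b"
proof (rule exists_primitive_trace_sieve[OF _ b, where C = "{2}" and R = "{5, 7, 13, 73}" and E = 27
      and \<delta> = "18817 / 33215"])
  have "q ^ n - 1 = 2 ^ 4 * (5 ^ 1 * (7 ^ 1 * (13 ^ 1 * (73 ^ 1 * 1))))"
    by (simp add: assms)
  also have "prime_factors \<dots> = {2, 5, 7, 13, 73}"
    by (intro prime_factors_mult_prime_power) simp_all
  finally show "prime_factors (q ^ n - 1) = {2} \<union> {5, 7, 13, 73}"
    by auto
  have "27 ^ 2 = (729 :: real)"
    by simp
  thus "27 = sqrt (q ^ (n - 6))"
    using real_sqrt_unique[of 27 729] by (simp add: assms)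
qed (simp_all add: assms)

text \<open>For \<open>q ^ d = 64\<close> the square root bound is insufficient for the primes 5 and 13, but these
  divide \<open>q ^ d + 1\<close>.\<close>
lemma exists_primitive_trace_64:
  assumes "q = 2" "n = 12" and b: "b \<in> K 6" "b \<noteq> 0"
  shows "\<exists>x. primitive_element x \<and> Tr n 6 x = b"
proof -
  have "q ^ n - 1 = 3 ^ 2 * (5 ^ 1 * (7 ^ 1 * (13 ^ 1 * 1)))"
    by (simp add: assms)
  also have "prime_factors \<dots> = {3, 5, 7, 13}"
    by (intro prime_factors_mult_prime_power) simp_all
  finally have P: "prime_factors (q ^ n - 1) = {3, 5, 7, 13}" .
  have d: "6 dvd n"
    by (simp add: assms)
  have fibre: "card {x. Tr n 6 x = b} = 64"
    using card_trace_fibre[OF d b(1)] by (simp add: assms)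
  have "sqrt 64 = (8 :: real)"
    using real_sqrt_unique[of 8 64] by simp
  hence sqrt: "sqrt (q ^ (n - 6)) = 8"
    by (simp add: assms)
  define B where "B l = (if l = 5 \<or> l = 13 then 1 else 8 :: real)" for l :: nat
  have "\<exists>x\<in>{x. Tr n 6 x = b}. \<forall>l\<in>{} \<union> {3, 5, 7, 13}. \<not> l dvd ind x"
  \<comment> \<open>As \<open>C\<close> is empty, \<open>B\<close> can be 0. Here
    \<open>\<delta>\<close> is \<open>1 - 1/3 - 1/5 - 1/7 - 1/13\<close>, and the sieve condition is
    roughly \<open>13.9 < 15.8\<close>.\<close>
  proof (rule sieve[where B = 0 and B' = B and \<delta> = "337 / 1365"])
    show "2 \<le> l" if "l \<in> {} \<union> {3, 5, 7, 13}" for l :: nat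
      using that by auto
  next
    fix T l :: "nat set" and r :: nat
    assume T: "T \<subseteq> {}" and r: "r \<in> {3, 5, 7, 13}"
    show "\<bar>\<Sum>x | Tr n 6 x = b. \<Prod>l\<in>insert r T. power_residue_weight l (l dvd ind x)\<bar> \<le> B r"
    proof (cases "r = 5 \<or> r = 13")
      case True
      thus ?thesis
        using T trace_weight_sum_quadratic_bound[of 6 b r] b assms by (auto simp: B_def)
    next
      case False
      thus ?thesis
        using T r trace_weight_sum_bound[OF d b, of "{r}", unfolded P sqrt] by (simp add: B_def)
    qed
  qed (simp_all add: fibre B_def)
  then obtain x where x: "Tr n 6 x = b" "\<And>l. l \<in> prime_factors (q ^ n - 1) \<Longrightarrow> \<not> l dvd ind x"
    using P by auto
  have "primitive_element x"
  proof (rule primitive_elementI)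
    show "x \<noteq> 0"
      using x b by auto
    show "\<not> l dvd ind x" if "prime l" "l dvd q ^ n - 1" for l
      using x(2) that qn_gt_1 by (simp add: prime_factors_dvd)
  qed
  thus ?thesis
    using x by blast
qed

text \<open>Of the ten small triples, eight satisfy the direct criterion;
  \<open>exists_primitive_trace_64\<close> and \<open>exists_primitive_trace_729\<close> cover the
  other two.\<close>

theorem exists_primitive_trace:
  assumes d: "d dvd n" "d < n" "d > 1" "\<not> primepow d" and b: "b \<in> K d" "b \<noteq> 0"
  shows "\<exists>x. primitive_element x \<and> Tr n d x = b"
proof (cases "330 ^ 2 \<le> q ^ (n - d)")
  case True
  obtain m where "n = d * m"
    using d(1) by auto
  hence "2 * d \<le> n"
    using d(2) by (cases m; cases "m - 1") auto
  thus ?thesis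
    using exists_primitive_trace_large[OF d(1) _ b True] by blast
next
  case False
  have "d dvd n - d" "n - d > 0"
    using d by auto
  with False have "(q, d, n - d) \<in> {(2, 6, 6), (3, 6, 6), (4, 6, 6), (5, 6, 6), (2, 10, 10),
     (3, 10, 10), (2, 12, 12), (2, 14, 14), (2, 15, 15), (2, 6, 12)}"
    using q d by (intro small_cases) auto
  then consider "q = 2" "d = 6" "n = 12" | "q = 3" "d = 6" "n = 12" | "q = 4" "d = 6" "n = 12"
    | "q = 5" "d = 6" "n = 12" | "q = 2" "d = 10" "n = 20" | "q = 3" "d = 10" "n = 20"
    | "q = 2" "d = 12" "n = 24" | "q = 2" "d = 14" "n = 28" | "q = 2" "d = 15" "n = 30"
    | "q = 2" "d = 6" "n = 18"
    by (auto; linarith)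
  thus ?thesis
  proof cases
    case 1
    thus ?thesis using exists_primitive_trace_64 b by blast
  next
    case 2
    thus ?thesis using exists_primitive_trace_729 b by blast
  next
    case 3
    hence "q ^ n - 1 = 3 ^ 2 * (5 ^ 1 * (7 ^ 1 * (13 ^ 1 * (17 ^ 1 * (241 ^ 1 * 1)))))"
      by simp
    also have "prime_factors \<dots> = {3, 5, 7, 13, 17, 241}"
      by (intro prime_factors_mult_prime_power) simp_all
    finally show ?thesis
      by (rule exists_primitive_trace_few_primes[OF d(1) b, of _ 6]) (simp_all add: 3)
  next
    case 4
    hence "q ^ n - 1 = 2 ^ 4 * (3 ^ 2 * (7 ^ 1 * (13 ^ 1 * (31 ^ 1 * (601 ^ 1 * 1)))))"
      by simp
    also have "prime_factors \<dots> = {2, 3, 7, 13, 31, 601}"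
      by (intro prime_factors_mult_prime_power) simp_all
    finally show ?thesis
      by (rule exists_primitive_trace_few_primes[OF d(1) b, of _ 6]) (simp_all add: 4)
  next
    case 5
    hence "q ^ n - 1 = 3 ^ 1 * (5 ^ 2 * (11 ^ 1 * (31 ^ 1 * (41 ^ 1 * 1))))"
      by simp
    also have "prime_factors \<dots> = {3, 5, 11, 31, 41}"
      by (intro prime_factors_mult_prime_power) simp_all
    finally show ?thesis
      by (rule exists_primitive_trace_few_primes[OF d(1) b, of _ 5]) (simp_all add: 5)
  next
    case 6
    hence "q ^ n - 1 = 2 ^ 4 * (5 ^ 2 * (11 ^ 2 * (61 ^ 1 * (1181 ^ 1 * 1))))"
      by simp
    also have "prime_factors \<dots> = {2, 5, 11, 61, 1181}"
      by (intro prime_factors_mult_prime_power prime_1181) simp_all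
    finally show ?thesis
      by (rule exists_primitive_trace_few_primes[OF d(1) b, of _ 5]) (simp_all add: 6)
  next
    case 7
    hence "q ^ n - 1 = 3 ^ 2 * (5 ^ 1 * (7 ^ 1 * (13 ^ 1 * (17 ^ 1 * (241 ^ 1 * 1)))))"
      by simp
    also have "prime_factors \<dots> = {3, 5, 7, 13, 17, 241}"
      by (intro prime_factors_mult_prime_power) simp_all
    finally show ?thesis
      by (rule exists_primitive_trace_few_primes[OF d(1) b, of _ 6]) (simp_all add: 7)
  next
    case 8
    hence "q ^ n - 1 = 3 ^ 1 * (5 ^ 1 * (29 ^ 1 * (43 ^ 1 * (113 ^ 1 * (127 ^ 1 * 1)))))"
      by simp
    also have "prime_factors \<dots> = {3, 5, 29, 43, 113, 127}"
      by (intro prime_factors_mult_prime_power) simp_all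
    finally show ?thesis
      by (rule exists_primitive_trace_few_primes[OF d(1) b, of _ 6]) (simp_all add: 8)
  next
    case 9
    hence "q ^ n - 1 = 3 ^ 2 * (7 ^ 1 * (11 ^ 1 * (31 ^ 1 * (151 ^ 1 * (331 ^ 1 * 1)))))"
      by simp
    also have "prime_factors \<dots> = {3, 7, 11, 31, 151, 331}"
      by (intro prime_factors_mult_prime_power) simp_all
    finally show ?thesis
      by (rule exists_primitive_trace_few_primes[OF d(1) b, of _ 6]) (simp_all add: 9)
  next
    case 10
    hence "q ^ n - 1 = 3 ^ 3 * (7 ^ 1 * (19 ^ 1 * (73 ^ 1 * 1)))"
      by simp
    also have "prime_factors \<dots> = {3, 7, 19, 73}"
      by (intro prime_factors_mult_prime_power) simp_all
    finally show ?thesis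
      by (rule exists_primitive_trace_few_primes[OF d(1) b, of _ 4]) (simp_all add: 10)
  qed
qed

text \<open>Since \<open>N \<notin> D\<close>, adding \<open>\<nu>\<close> changes no prescribed
  trace, and \<open>b\<close> and \<open>b + \<nu>\<close> are not both 0.\<close>

lemma exists_prescribed_traces_nonzero:
  assumes "N dvd n" and D: "D \<subseteq> {f. f dvd N}" "N \<notin> D"
    and "\<And>e f. e \<in> D \<Longrightarrow> f dvd e \<Longrightarrow> f \<in> D"
    and "\<And>e. e \<in> D \<Longrightarrow> a e \<in> K e"
    and "\<And>e f. e \<in> D \<Longrightarrow> f dvd e \<Longrightarrow> Tr e f (a e) = a f"
  shows "\<exists>b\<in>K N. b \<noteq> 0 \<and> (\<forall>e\<in>D. Tr N e b = a e)"
proof -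
  obtain b where b: "b \<in> K N" "\<forall>e\<in>D. Tr N e b = a e"
    using exists_prescribed_traces[of N D a, OF assms(1) D(1)] assms(4-) by blast
  obtain \<nu> where \<nu>: "\<nu> \<in> K N" "\<nu> \<noteq> 0" "\<And>f. f dvd N \<Longrightarrow> f \<noteq> N \<Longrightarrow> Tr N f \<nu> = 0"
    using exists_nonzero_traces_zero[OF assms(1)] by blast
  have "\<forall>e\<in>D. Tr N e (b + \<nu>) = a e"
    using D b \<nu> by (auto simp: Tr_add)
  moreover have "b + \<nu> \<in> K N"
    using b \<nu> by (simp add: K_add)
  ultimately show ?thesis
    using b \<nu> by (cases "b = 0") auto
qed

end

theorem theorem2p5:
  fixes q n k :: nat and ds :: "nat list" and as :: "'a :: finite_field list"
  assumes "primepow q"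
    and "CARD('a) = q ^ n"
    and "n > 1"
    and "\<not> primepow n"
    and "1 < k"
    and "k < card {d. d dvd n}"
    and "ds \<in> divisor_tuples k n"
    and "as \<in> field_tuples q ds"
    and "admissible q ds as"
    and "Lcm (set ds) < n"
  shows "\<exists>\<alpha> :: 'a. primitive_element \<alpha> \<and> (\<forall>i<k. field_trace q n (ds ! i) \<alpha> = as ! i)"
proof -
  interpret finite_field_tower q n "TYPE('a)"
    by unfold_locales (use assms in auto)
  define N where "N = Lcm (set ds)"
  have len: "length ds = k"
    and dvd_n: "\<And>i. i < k \<Longrightarrow> ds ! i dvd n"
    and antichain: "\<And>i j. i < k \<Longrightarrow> j < k \<Longrightarrow> i \<noteq> j \<Longrightarrow> \<not> ds ! i dvd ds ! j"
    using assms by (auto simp: divisor_tuples_def)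
  have pos: "ds ! i > 0" if "i < k" for i
    using dvd_n_pos dvd_n that by blast
  have asK: "as ! i \<in> K (ds ! i)" if "i < k" for i
    using assms that len subfield_of_card_eq[OF q card pos[OF that] dvd_n[OF that]]
    by (auto simp: field_tuples_def K_def)
  have N: "N dvd n"
    unfolding N_def using assms by (intro Lcm_least) (auto simp: divisor_tuples_def)
  hence "N > 0"
    by (rule dvd_n_pos)
  have dvd_N: "ds ! i dvd N" if "i < k" for i
    unfolding N_def using that len by (intro dvd_Lcm) auto
  have adm: "Tr (ds ! i) (gcd (ds ! i) (ds ! j)) (as ! i) = Tr (ds ! j) (gcd (ds ! i) (ds ! j)) (as ! j)"
    if "i < k" "j < k" for i j
  proof -
    consider "i < j" | "j < i" | "i = j"
      by linarith
    thus ?thesis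
      using assms(9) that len by cases (auto simp: admissible_def gcd.commute)
  qed
  \<comment> \<open>Admissibility compares traces at the gcd; a common divisor \<open>e\<close>
    divides it, so transitivity applies.\<close>
  have consistent: "Tr (ds ! i) e (as ! i) = Tr (ds ! j) e (as ! j)"
    if "i < k" "j < k" "e dvd ds ! i" "e dvd ds ! j" for i j e
    using adm[OF that(1,2)] Tr_trans[of e "gcd (ds ! i) (ds ! j)" "ds ! i" "as ! i"]
      Tr_trans[of e "gcd (ds ! i) (ds ! j)" "ds ! j" "as ! j"] that pos by simp
  define D where "D = {e. \<exists>i<k. e dvd ds ! i}"
  \<comment> \<open>Which index is chosen does not matter, by \<open>consistent\<close>.\<close>
  define idx where "idx e = (SOME i. i < k \<and> e dvd ds ! i)" for e
  have idx: "idx e < k" "e dvd ds ! idx e" if "e \<in> D" for e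
    using that someI_ex[of "\<lambda>i. i < k \<and> e dvd ds ! i"] by (auto simp: D_def idx_def)
  define a where "a e = Tr (ds ! idx e) e (as ! idx e)" for e
  have a_eq: "a e = Tr (ds ! i) e (as ! i)" if "i < k" "e dvd ds ! i" for e i
    unfolding a_def using that idx[of e] by (intro consistent) (auto simp: D_def)
  \<comment> \<open>A member of the antichain divisible by \<open>N\<close> would be divisible by
    another member, which exists as \<open>k > 1\<close>.\<close>
  have ND: "N \<notin> D"
  proof
    assume "N \<in> D"
    then obtain i where i: "i < k" "N dvd ds ! i"
      by (auto simp: D_def)
    define j where "j = (if i = 0 then 1 else 0 :: nat)"
    have "j < k" "j \<noteq> i"
      using assms by (auto simp: j_def)
    thus False
      using i antichain dvd_N dvd_trans by blast
  qed
  have "\<exists>b\<in>K N. b \<noteq> 0 \<and> (\<forall>e\<in>D. Tr N e b = a e)"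
  proof (rule exists_prescribed_traces_nonzero[OF N _ ND])
    show "D \<subseteq> {f. f dvd N}"
      using dvd_N by (auto simp: D_def intro: dvd_trans)
    show "f \<in> D" if "e \<in> D" "f dvd e" for e f
      using that by (auto simp: D_def intro: dvd_trans)
    show "a e \<in> K e" if "e \<in> D" for e
      unfolding a_def using idx[OF that] asK pos by (intro Tr_in_K) auto
    show "Tr e f (a e) = a f" if "e \<in> D" "f dvd e" for e f
      using Tr_trans[OF that(2) idx(2)[OF that(1)] pos] idx[OF that(1)] that
        a_eq[of "idx e" f] by (auto simp: a_def intro: dvd_trans)
  qed
  then obtain b where b: "b \<in> K N" "b \<noteq> 0" "\<And>e. e \<in> D \<Longrightarrow> Tr N e b = a e"
    by blast
  have "\<not> primepow N"
    using dvd_N[of 0] dvd_N[of 1] antichain[of 0 1] antichain[of 1 0] assms(5)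
    by (intro incomparable_divisors_imp_not_primepow) auto
  moreover have "N \<noteq> 1"
    using dvd_N[of 0] antichain[of 0 1] assms(5) by auto
  ultimately obtain \<alpha> where \<alpha>: "primitive_element \<alpha>" "Tr n N \<alpha> = b"
    using exists_primitive_trace[OF N _ _ _ b(1,2)] assms(10) \<open>N > 0\<close> by (auto simp: N_def)
  have "Tr n (ds ! i) \<alpha> = as ! i" if "i < k" for i
  proof -
    have "Tr n (ds ! i) \<alpha> = Tr N (ds ! i) b"
      using Tr_trans[OF dvd_N[OF that] N n_pos] \<alpha> by metis
    moreover have "ds ! i \<in> D"
      unfolding D_def using that by (auto intro!: exI[of _ i])
    hence "Tr N (ds ! i) b = Tr (ds ! i) (ds ! i) (as ! i)"
      using b(3)[of "ds ! i"] a_eq[OF that, of "ds ! i"] by simp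
    ultimately show ?thesis
      using Tr_self[OF pos[OF that]] by simp
  qed
  thus ?thesis
    using \<alpha> by blast
qed

end
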